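(* Let $\mathfrak v$ be a finite prime of $A=\mathbb F_q[\theta]$ with monic generator $g=p_{\mathfrak v}$. Let $k_0,n$ be positive integers such that $k_0-2n$ is a positive multiple of $q-1$ and $n\le p^{\operatorname{ord}_p(k_0-n)}$, and put $f_0:=\sum_{a\in A_{\mathfrak v,+}} a^{k_0-n}G_n(u_a)$, viewed as a power series in $u$. Then $\hat T_g f_0=g^nf_0$.
   Context: $q=p^{m_0}$, $A=\mathbb F_q[\theta]$, $K=\mathbb F_q(\theta)$, $\mathbb C_\infty$ the completion of an algebraic closure of $\mathbb F_q((1/\theta))$; $A_+$ = monic elements of $A$, and $A_{\mathfrak v,+}$ = monic elements of $A$ prime to $\mathfrak v$. $C$ is the Carlitz module with period $\tilde\pi$, lattice $\Lambda_C=A\tilde\pi$ and exponential $e_C$. For an $\mathbb F_q$-lattice $\Lambda\subset\mathbb C_\infty$, $e_\Lambda(z)=z\prod_{0\neq\lambda\in\Lambda}(1-z/\lambda)$, and for $j\ge1$ the Goss polynomial $G_{j,\Lambda}(X)$ is the monic degree-$j$ polynomial with $G_{j,\Lambda}(1/e_\Lambda(z))=\sum_{\lambda\in\Lambda}(z+\lambda)^{-j}$; $G_n:=G_{n,\Lambda_C}$. Set $u(z)=1/e_C(\tilde\pi z)$ and $u_a=u(az)$ for $a\in A_+$, a power series in $u$ with coefficients in $K$. $\Lambda_g\subset\mathbb C_\infty$ denotes the $\mathbb F_q$-module of $g$-division points of the Carlitz module. For a power series $F=\sum_{j\ge0}c_ju^j$ with $c_0=0$, $\hat T_gF:=\sum_{j\ge1}c_jG_{j,\Lambda_g}(gu)$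 (for a modular form $F$ this is the $u$-expansion of $\sum_{\deg\beta<\deg g}F((z+\beta)/g)$). *)

theory Defs
  imports
    "HOL-Analysis.Infinite_Sum"
    "HOL-Computational_Algebra.Formal_Laurent_Series"
    "HOL-Library.Cardinality"
begin

text \<open>
  \<open>\<iota>\<close> exhibits the type \<open>'c\<close> as the completion of an algebraic closure of
  \<open>F\<^sub>q((1/\<theta>))\<close>, where \<open>F\<^sub>q = 'q\<close>. The variable of the Laurent series type is \<open>1/\<theta>\<close>,
  and the absolute value of \<open>'c\<close> is \<open>\<lambda>x. dist 0 x\<close>, normalised by \<open>\<bar>\<theta>\<bar> = q\<close>.
  The algebraic closure in question is the set of all elements of \<open>'c\<close> that are
  algebraic over the image of \<open>\<iota>\<close>.
\<close>

definition algebraic_elements :: "('q::{field,finite} fls \<Rightarrow> 'c::field) \<Rightarrow> 'c set" where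
  "algebraic_elements \<iota> = {x. \<exists>p. p \<noteq> 0 \<and> poly (map_poly \<iota> p) x = 0}"

locale C_infty =
  fixes \<iota> :: "'q::{field,finite} fls \<Rightarrow> 'c::{field,complete_space}"
  assumes embedding_one: "\<iota> 1 = 1"
    and embedding_add: "\<iota> (f + h) = \<iota> f + \<iota> h"
    and embedding_mult: "\<iota> (f * h) = \<iota> f * \<iota> h"
    and dist_translate: "dist (x + z) (y + z) = dist x (y::'c)"
    and dist_mult: "dist 0 (x * y) = dist 0 x * dist 0 (y::'c)"
    and dist_ultrametric: "dist x z \<le> max (dist x y) (dist y (z::'c))"
    and dist_embedding:
      "f \<noteq> 0 \<Longrightarrow> dist 0 (\<iota> f) = real CARD('q) powi (- fls_subdegree f)"
    and algebraically_closed: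
      "(\<And>i. coeff p i \<in> algebraic_elements \<iota>) \<Longrightarrow> 0 < degree p \<Longrightarrow>
         \<exists>x \<in> algebraic_elements \<iota>. poly p x = 0"
    and algebraic_dense: "closure (algebraic_elements \<iota>) = UNIV"

definition theta :: "('q::field fls \<Rightarrow> 'c) \<Rightarrow> 'c" where
  "theta \<iota> = \<iota> fls_X_inv"

definition const_emb :: "('q::field fls \<Rightarrow> 'c) \<Rightarrow> 'q \<Rightarrow> 'c" where
  "const_emb \<iota> c = \<iota> (fls_const c)"

text \<open>The ring \<open>A = F\<^sub>q[\<theta>]\<close> is \<open>'q poly\<close>; it sits inside \<open>'c\<close> by evaluation at \<open>\<theta>\<close>.\<close>

definition A_emb :: "('q::field fls \<Rightarrow> 'c::field) \<Rightarrow> 'q poly \<Rightarrow> 'c" where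
  "A_emb \<iota> a = (\<Sum>i\<le>degree a. const_emb \<iota> (coeff a i) * theta \<iota> ^ i)"

definition carlitz_theta :: "('q::{field,finite} fls \<Rightarrow> 'c::field) \<Rightarrow> 'c \<Rightarrow> 'c" where
  "carlitz_theta \<iota> x = theta \<iota> * x + x ^ CARD('q)"

definition carlitz :: "('q::{field,finite} fls \<Rightarrow> 'c::field) \<Rightarrow> 'q poly \<Rightarrow> 'c \<Rightarrow> 'c" where
  "carlitz \<iota> a x = (\<Sum>i\<le>degree a. const_emb \<iota> (coeff a i) * (carlitz_theta \<iota> ^^ i) x)"

definition division_points :: "('q::{field,finite} fls \<Rightarrow> 'c::field) \<Rightarrow> 'q poly \<Rightarrow> 'c set" where
  "division_points \<iota> g = {x. carlitz \<iota> g x = 0}"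

definition lattice_exp :: "'c::{field,complete_space} set \<Rightarrow> 'c \<Rightarrow> 'c" where
  "lattice_exp \<Lambda> z =
     z * Lim (finite_subsets_at_top (\<Lambda> - {0})) (\<lambda>S. \<Prod>w\<in>S. 1 - z / w)"

definition goss_poly :: "nat \<Rightarrow> 'c::{field,complete_space} set \<Rightarrow> 'c poly" where
  "goss_poly j \<Lambda> = (THE G. lead_coeff G = 1 \<and> degree G = j \<and>
     (\<forall>z. z \<notin> \<Lambda> \<longrightarrow>
        ((\<lambda>w. inverse ((z + w) ^ j)) has_sum poly G (inverse (lattice_exp \<Lambda> z))) \<Lambda>))"

definition carlitz_lattice :: "('q::field fls \<Rightarrow> 'c::field) \<Rightarrow> 'c \<Rightarrow> 'c set" where
  "carlitz_lattice \<iota> \<pi> = range (\<lambda>a. A_emb \<iota> a * \<pi>)"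

text \<open>
  \<open>\<pi>\<close> is a period of the Carlitz module if \<open>A\<pi>\<close> is its lattice under analytic
  uniformisation, i.e. if the exponential of the lattice \<open>A\<pi>\<close> intertwines
  multiplication by \<open>a\<close> with \<open>C\<^sub>a\<close>; then that exponential is \<open>e\<^sub>C\<close>.
  This determines \<open>\<pi>\<close> up to a factor in the nonzero elements of \<open>F\<^sub>q\<close>.
\<close>

definition carlitz_period ::
  "('q::{field,finite} fls \<Rightarrow> 'c::{field,complete_space}) \<Rightarrow> 'c \<Rightarrow> bool" where
  "carlitz_period \<iota> \<pi> \<longleftrightarrow> \<pi> \<noteq> 0 \<and>
     (\<forall>a z. lattice_exp (carlitz_lattice \<iota> \<pi>) (A_emb \<iota> a * z) =
            carlitz \<iota> a (lattice_exp (carlitz_lattice \<iota> \<pi>) z))"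

definition u_param :: "('q::field fls \<Rightarrow> 'c::{field,complete_space}) \<Rightarrow> 'c \<Rightarrow> 'c \<Rightarrow> 'c" where
  "u_param \<iota> \<pi> z = inverse (lattice_exp (carlitz_lattice \<iota> \<pi>) (\<pi> * z))"

text \<open>
  The power series that represents a function of \<open>z\<close> for small \<open>\<bar>u(z)\<bar>\<close>. The poles
  \<open>z \<in> A\<close> of \<open>u\<close> have to be excluded, since there \<open>inverse 0 = 0\<close> gives \<open>u(z)\<close> the value 0.
\<close>

definition u_expansion ::
  "('q::field fls \<Rightarrow> 'c::{field,complete_space}) \<Rightarrow> 'c \<Rightarrow> ('c \<Rightarrow> 'c) \<Rightarrow> 'c fps" where
  "u_expansion \<iota> \<pi> f = (THE P. \<exists>r>0. \<forall>z. z \<notin> range (A_emb \<iota>) \<and> dist 0 (u_param \<iota> \<pi> z) < r \<longrightarrow>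
     (\<lambda>n. fps_nth P n * u_param \<iota> \<pi> z ^ n) sums f z)"

definition u_sub ::
  "('q::field fls \<Rightarrow> 'c::{field,complete_space}) \<Rightarrow> 'c \<Rightarrow> 'q poly \<Rightarrow> 'c fps" where
  "u_sub \<iota> \<pi> a = u_expansion \<iota> \<pi> (\<lambda>z. u_param \<iota> \<pi> (A_emb \<iota> a * z))"

definition poly_fps :: "'c::field poly \<Rightarrow> 'c fps \<Rightarrow> 'c fps" where
  "poly_fps G F = poly (map_poly fps_const G) F"

text \<open>
  Infinite sums of power series are taken in the topology of the type \<open>'c fps\<close>, that
  is, \<open>u\<close>-adically; the topology of the coefficients plays no role. In \<open>f_zero\<close>, \<open>k\<close> and \<open>n\<close>
  are such that \<open>n \<le> k\<close>.
\<close>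

definition f_zero ::
  "('q::{field,finite} fls \<Rightarrow> 'c::{field,complete_space}) \<Rightarrow> 'c \<Rightarrow> 'q poly \<Rightarrow> nat \<Rightarrow> nat \<Rightarrow> 'c fps" where
  "f_zero \<iota> \<pi> g k n =
     (\<Sum>\<^sub>\<infinity>a \<in> {a. lead_coeff a = 1 \<and> \<not> g dvd a}.
        fps_const (A_emb \<iota> a ^ (k - n)) *
        poly_fps (goss_poly n (carlitz_lattice \<iota> \<pi>)) (u_sub \<iota> \<pi> a))"

definition T_hat ::
  "('q::{field,finite} fls \<Rightarrow> 'c::{field,complete_space}) \<Rightarrow> 'q poly \<Rightarrow> 'c fps \<Rightarrow> 'c fps" where
  "T_hat \<iota> g F =
     (\<Sum>\<^sub>\<infinity>j \<in> {1..}. fps_const (fps_nth F j) *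
        poly_fps (goss_poly j (division_points \<iota> g)) (fps_const (A_emb \<iota> g) * fps_X))"

end

theory Submission
  imports Defs "HOL-Computational_Algebra.Polynomial_Factorial"
begin

text \<open>
  Write \<open>V\<^sub>a\<close> for the expansion of \<open>u\<^sub>a\<close>; as \<open>e\<^sub>C(az) = C\<^sub>a(e\<^sub>C(z))\<close>, it is the power series
  \<open>1/C\<^sub>a(1/X)\<close>. For a finite additive group \<open>L\<close> the series \<open>G\<^sub>j(X)\<close> of \<open>L\<close> satisfies
  \<open>G\<^sub>j(1/e\<^sub>L(y)) = \<Sum>\<^sub>m (y + m)\<^sup>-\<^sup>j\<close>, and \<open>e\<^sub>L = C\<^sub>g/g\<close> for the division points \<open>L\<close> of \<open>g\<close>. Hence
  \<open>T\<^sub>g\<close> is a trace: the series \<open>T\<^sub>g F\<close> composed with \<open>V\<^sub>g\<close> is the sum over \<open>m \<in> L\<close> of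
  \<open>F(X/(1 + m X))\<close>. Since \<open>C\<^sub>a(y + m) = C\<^sub>a(y) + C\<^sub>a(m)\<close> and \<open>C\<^sub>a\<close> permutes \<open>L\<close> when \<open>g\<close> does not
  divide \<open>a\<close>, and since \<open>C\<^sub>a\<close> and \<open>C\<^sub>g\<close> commute, the identity \<open>T\<^sub>g (G\<^sub>n(u\<^sub>a)) = g\<^sup>n G\<^sub>n(u\<^sub>a)\<close> reduces to
  \<open>\<Sum>\<^sub>m G\<^sub>n(1/(y + m)) = g\<^sup>n G\<^sub>n(1/C\<^sub>g(y))\<close>, which holds at \<open>y = e\<^sub>C(z)\<close> because \<open>A\<close> is the
  disjoint union of the residue classes modulo \<open>g\<close>. So \<open>T\<^sub>g\<close> multiplies every single term of the
  sum \<open>f\<^sub>0\<close> by \<open>g\<^sup>n\<close>.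
\<close>

section \<open>Goss polynomials of finite groups and reciprocals of polynomials\<close>

text \<open>For finite \<open>L\<close> this is \<open>lattice_exp L\<close> as a polynomial. The
  zero of \<open>L\<close> is split off as the factor \<open>X\<close>, so the linear coefficient is
  1.\<close>

definition exp_poly :: "'a::field set \<Rightarrow> 'a poly" where
  "exp_poly L = pCons 0 (\<Prod>w\<in>L - {0}. [:1, - inverse w:])"

text \<open>The recursion is that of the coefficients of \<open>X T / (1 - X \<Sum>\<^sub>m \<beta>\<^sub>m T\<^sup>m)\<close> as a power series
  in \<open>T\<close>.\<close>

fun goss :: "(nat \<Rightarrow> 'a::comm_ring_1) \<Rightarrow> nat \<Rightarrow> 'a poly" where
  "goss \<beta> 0 = 0"
| "goss \<beta> (Suc j) =
     pCons 0 ((if j = 0 then 1 else 0) + (\<Sum>m=1..j. smult (\<beta> m) (goss \<beta> (Suc j - m))))"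

declare goss.simps(2) [simp del]

text \<open>Only the indices 1 to \<open>j\<close> of \<open>s\<close> occur on the right, so the
  recursion determines every \<open>s j\<close> with \<open>j > 0\<close>. It is applied to power
  sums \<open>s\<close> and to \<open>x = 1/e(z)\<close>.\<close>

lemma poly_goss_eqI:
  assumes "\<And>j. s (Suc j) = x * ((if j = 0 then 1 else 0) + (\<Sum>m=1..j. \<beta> m * s (Suc j - m)))"
    and "0 < j"
  shows "poly (goss \<beta> j) x = s j"
  using assms(2)
proof (induction j rule: less_induct)
  case (less j)
  then obtain i where i: "j = Suc i" by (cases j) auto
  have "(\<Sum>m=1..i. \<beta> m * poly (goss \<beta> (Suc i - m)) x) = (\<Sum>m=1..i. \<beta> m * s (Suc i - m))"
    using less.IH i by (intro sum.cong) auto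
  then show ?case
    using assms(1)[of i] by (auto simp: i goss.simps(2) poly_sum)
qed

lemma coeff_goss_0 [simp]: "coeff (goss \<beta> j) 0 = 0"
  by (cases j) (simp_all add: goss.simps(2))

text \<open>The term \<open>m = 1\<close> contributes \<open>X\<close> times the preceding
  polynomial because \<open>\<beta> 1 = 1\<close>; the terms with \<open>m \<ge> 2\<close> have
  smaller degree.\<close>

lemma degree_goss_monic:
  fixes \<beta> :: "nat \<Rightarrow> 'a::idom"
  assumes "\<beta> 1 = 1" "0 < j"
  shows "degree (goss \<beta> j) = j \<and> lead_coeff (goss \<beta> j) = 1"
  using assms(2)
proof (induction j rule: less_induct)
  case (less j)
  show ?case
  proof (cases "j = 1")
    case True
    then show ?thesis by (simp add: goss.simps(2))
  next
    case False
    with less.prems obtain i where i: "j = Suc (Suc i)"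
      by (metis One_nat_def gr0_implies_Suc not_gr_zero)
    define r where "r = (\<Sum>m=2..Suc i. smult (\<beta> m) (goss \<beta> (Suc (Suc i) - m)))"
    have IH: "degree (goss \<beta> (Suc i)) = Suc i" "lead_coeff (goss \<beta> (Suc i)) = 1"
      using less.IH[of "Suc i"] i by auto
    have "(\<Sum>m=1..Suc i. smult (\<beta> m) (goss \<beta> (Suc (Suc i) - m))) = goss \<beta> (Suc i) + r"
      unfolding r_def using assms(1)
      by (subst sum.atLeast_Suc_atMost) (auto simp: numeral_2_eq_2)
    then have g: "goss \<beta> j = pCons 0 (goss \<beta> (Suc i) + r)"
      by (simp add: i goss.simps(2) del: sum.atLeast_Suc_atMost)
    have "degree r < Suc i"
      unfolding r_def
    proof (intro degree_sum_less)
      fix m assume m: "m \<in> {2..Suc i}"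
      have "degree (goss \<beta> (Suc (Suc i) - m)) = Suc (Suc i) - m"
        using less.IH[of "Suc (Suc i) - m"] m i by auto
      then show "degree (smult (\<beta> m) (goss \<beta> (Suc (Suc i) - m))) < Suc i"
        using m by (intro le_less_trans[OF degree_smult_le]) auto
    qed auto
    then have "degree (goss \<beta> (Suc i) + r) = Suc i" "coeff (goss \<beta> (Suc i) + r) (Suc i) = 1"
      using IH by (auto simp: degree_add_eq_left coeff_eq_0)
    then show ?thesis
      unfolding g by (auto simp: i)
  qed
qed

text \<open>Each use of the recursion gains a factor \<open>X\<close> and lowers the index by at
  most \<open>N\<close>, so \<open>goss \<beta> j\<close> vanishes at 0 to order at least
  \<open>j / N\<close>. This is what makes the series defining \<open>T_hat\<close> converge
  u-adically.\<close>

lemma coeff_goss_eq_0: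
  fixes \<beta> :: "nat \<Rightarrow> 'a::idom"
  assumes "\<And>m. N < m \<Longrightarrow> \<beta> m = 0" "0 < N" "N * k < j"
  shows "coeff (goss \<beta> j) k = 0"
  using assms(3)
proof (induction j arbitrary: k rule: less_induct)
  case (less j)
  show ?case
  proof (cases k)
    case (Suc k')
    obtain i where i: "j = Suc i" using less.prems by (cases j) auto
    have "0 < i" using less.prems assms(2) i Suc by (cases i) auto
    moreover have "\<beta> m * coeff (goss \<beta> (Suc i - m)) k' = 0" if m: "m \<in> {1..i}" for m
    proof (cases "N < m")
      case False
      then have "N * k' < Suc i - m"
        using less.prems by (simp add: i Suc)
      then show ?thesis using less.IH[of "Suc i - m" k'] m i by simp
    qed (use assms(1) in simp)
    ultimately show ?thesis
      by (simp add: i Suc goss.simps(2) coeff_sum sum.neutral)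
  qed simp
qed

section \<open>Finite additive groups: additivity of the exponential and power sums\<close>

locale finite_subgroup =
  fixes L :: "'a::field set"
  assumes finite_L: "finite L"
    and zero_mem: "0 \<in> L"
    and diff_mem: "x \<in> L \<Longrightarrow> y \<in> L \<Longrightarrow> x - y \<in> L"
begin

lemma minus_mem: "x \<in> L \<Longrightarrow> - x \<in> L"
  using diff_mem[OF zero_mem] by simp

lemma add_mem: "x \<in> L \<Longrightarrow> y \<in> L \<Longrightarrow> x + y \<in> L"
  using diff_mem[of x "- y"] minus_mem[of y] by simp

lemma card_pos: "0 < card L"
  using finite_L zero_mem by (auto simp: card_gt_0_iff)

lemma exp_poly_eq_smult:
  "exp_poly L = smult (\<Prod>w\<in>L - {0}. - inverse w) (\<Prod>w\<in>L. [:- w, 1:])"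
proof -
  have "(\<Prod>w\<in>L. [:- w, 1:]) = [:0, 1:] * (\<Prod>w\<in>L - {0}. [:- w, 1:])"
    using finite_L zero_mem by (subst prod.remove[of L 0]) auto
  moreover have "(\<Prod>w\<in>L - {0}. [:1, - inverse w:]) = (\<Prod>w\<in>L - {0}. smult (- inverse w) [:- w, 1:])"
    by (intro prod.cong) auto
  ultimately show ?thesis
    by (simp only: exp_poly_def prod_smult) simp
qed

lemma lead_prod_nonzero: "(\<Prod>w\<in>L - {0}. - inverse w) \<noteq> 0"
  using finite_L by auto

lemma degree_exp_poly: "degree (exp_poly L) = card L"
  using lead_prod_nonzero
  by (simp add: exp_poly_eq_smult degree_prod_sum_eq)

lemma exp_poly_eq_0_iff: "poly (exp_poly L) x = 0 \<longleftrightarrow> x \<in> L"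
  using lead_prod_nonzero finite_L
  by (auto simp: exp_poly_eq_smult poly_prod)

lemma coeff_exp_poly_0: "coeff (exp_poly L) 0 = 0"
  by (simp add: exp_poly_def)

lemma coeff_exp_poly_1: "coeff (exp_poly L) 1 = 1"
  by (simp add: exp_poly_def flip: poly_0_coeff_0) (simp add: poly_prod)

lemma poly_exp_poly_periodic:
  assumes "l \<in> L"
  shows "poly (exp_poly L) (x + l) = poly (exp_poly L) x"
proof -
  have "(\<Prod>w\<in>L. x + l - w) = (\<Prod>w\<in>L. x - w)"
    by (rule prod.reindex_bij_witness[of _ "\<lambda>w. w + l" "\<lambda>w. w - l"])
       (use assms add_mem diff_mem in \<open>auto simp: algebra_simps\<close>)
  then show ?thesis
    by (simp add: exp_poly_eq_smult poly_prod algebra_simps)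
qed

text \<open>Both sides have degree at most \<open>card L\<close> and the same coefficient there, and
  by periodicity they agree at the \<open>card L\<close> points of \<open>L\<close>.\<close>

lemma pcompose_exp_poly:
  "pcompose (exp_poly L) [:y, 1:] = exp_poly L + [:poly (exp_poly L) y:]"
proof (rule poly_eqI_degree_lead_coeff[where n = "card L" and A = L])
  have "degree (pcompose (exp_poly L) [:y, 1:]) = card L"
    by (simp add: degree_pcompose degree_exp_poly)
  then have "coeff (pcompose (exp_poly L) [:y, 1:]) (card L) = lead_coeff (pcompose (exp_poly L) [:y, 1:])"
    by (simp only:)
  also have "\<dots> = lead_coeff (exp_poly L)"
    by (subst lead_coeff_comp) auto
  finally show "coeff (pcompose (exp_poly L) [:y, 1:]) (card L) =
      coeff (exp_poly L + [:poly (exp_poly L) y:]) (card L)"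
    using card_pos by (simp add: degree_exp_poly coeff_pCons split: nat.split)
next
  show "degree (exp_poly L + [:poly (exp_poly L) y:]) \<le> card L"
    by (intro degree_add_le) (auto simp: degree_exp_poly)
next
  fix z assume "z \<in> L"
  then show "poly (pcompose (exp_poly L) [:y, 1:]) z = poly (exp_poly L + [:poly (exp_poly L) y:]) z"
    using exp_poly_eq_0_iff[of z] by (simp add: poly_pcompose poly_exp_poly_periodic)
qed (auto simp: degree_pcompose degree_exp_poly)

lemma poly_exp_poly_add:
  "poly (exp_poly L) (x + y) = poly (exp_poly L) x + poly (exp_poly L) y"
  using arg_cong[OF pcompose_exp_poly[of y], of "\<lambda>p. poly p x"]
  by (simp add: poly_pcompose add.commute)

text \<open>Differentiating \<open>E(T + y) = E(T) + E(y)\<close> at \<open>T = 0\<close> shows that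
  \<open>E'\<close> takes the value \<open>E'(0) = 1\<close> at every \<open>y\<close>; over an
  infinite field it is therefore constant.\<close>

lemma pderiv_exp_poly:
  assumes "infinite (UNIV :: 'a set)"
  shows "pderiv (exp_poly L) = 1"
proof -
  have "poly (pderiv (exp_poly L)) y = 1" for y
  proof -
    have "poly (pderiv (pcompose (exp_poly L) [:y, 1:])) 0 = poly (pderiv (exp_poly L)) 0"
      by (simp add: pcompose_exp_poly pderiv_add pderiv_pCons)
    also have "\<dots> = 1"
      using coeff_exp_poly_1 by (simp add: poly_0_coeff_0 coeff_pderiv)
    finally show ?thesis
      by (simp add: pderiv_pcompose poly_pcompose pderiv_pCons)
  qed
  then have "{y. poly (pderiv (exp_poly L) - 1) y = 0} = UNIV" by auto
  then show ?thesis
    using poly_roots_finite[of "pderiv (exp_poly L) - 1"] assms by auto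
qed

text \<open>Logarithmic differentiation of \<open>1 - E(T)/E(z) = \<Prod>(1 - T/(z + l))\<close>.\<close>

lemma power_sum_recursion:
  assumes "infinite (UNIV :: 'a set)" and z: "z \<notin> L"
  defines "s \<equiv> \<lambda>j. \<Sum>l\<in>L. inverse ((z + l) ^ j)"
  shows "s (Suc j) = inverse (poly (exp_poly L) z) *
    ((if j = 0 then 1 else 0) + (\<Sum>m=1..j. coeff (exp_poly L) m * s (Suc j - m)))"
proof -
  define E where "E = exp_poly L"
  define x where "x = inverse (poly E z)"
  define r where "r = (\<lambda>l. inverse (z + l))"
  define q where "q = (\<Prod>l\<in>L. [:1, - r l:])"
  define S where "S = Abs_fps (\<lambda>j. s (Suc j))"
  have zl: "z + l \<noteq> 0" if "l \<in> L" for l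
    using z minus_mem[OF that] by (auto simp: add_eq_0_iff2)
  have Ez: "poly E z \<noteq> 0"
    using z by (simp add: E_def exp_poly_eq_0_iff)
  \<comment> \<open>Both sides are 1 at 0 and vanish at the \<open>card L\<close> points
    \<open>z + l\<close>, and their degrees are at most \<open>card L\<close>.\<close>
  have "q = 1 - smult x E"
  proof (rule poly_eqI_degree[of "insert 0 ((+) z ` L)"])
    fix t assume "t \<in> insert 0 ((+) z ` L)"
    then consider "t = 0" | l where "t = z + l" "l \<in> L" by auto
    then show "poly q t = poly (1 - smult x E) t"
    proof cases
      case 1
      then show ?thesis by (simp add: q_def poly_prod E_def coeff_exp_poly_0 flip: poly_0_coeff_0)
        (simp add: poly_0_coeff_0 coeff_exp_poly_0)
    next
      case (2 l)
      then have "poly q t = 0"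
        using finite_L zl[OF 2(2)] by (auto simp: q_def poly_prod r_def intro!: bexI[of _ l])
      moreover have "poly E t = poly E z"
        using 2 by (simp add: E_def poly_exp_poly_periodic)
      ultimately show ?thesis using Ez by (simp add: x_def)
    qed
  next
    have "0 \<notin> (+) z ` L" using zl by fastforce
    then have card: "card (insert 0 ((+) z ` L)) = Suc (card L)"
      using finite_L by (simp add: card_image)
    have "degree q \<le> (\<Sum>l\<in>L. degree [:1, - r l:])"
      unfolding q_def using degree_prod_sum_le[OF finite_L, of "\<lambda>l. [:1, - r l:]"]
      by (simp only: o_def)
    also have "\<dots> \<le> (\<Sum>l\<in>L. 1)"
      by (intro sum_mono) auto
    finally have "degree q \<le> (\<Sum>l\<in>L. 1)" .
    then show "degree q < card (insert 0 ((+) z ` L))"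
      using card by simp
    have "degree (1 - smult x E) \<le> card L"
      by (intro degree_diff_le) (auto simp: E_def degree_exp_poly)
    then show "degree (1 - smult x E) < card (insert 0 ((+) z ` L))"
      using card by simp
  qed
  then have q_fps: "fps_of_poly q = 1 - fps_const x * fps_of_poly E"
    and dq: "pderiv q = - [:x:]"
    using pderiv_exp_poly[OF assms(1)]
    by (auto simp: fps_of_poly_diff fps_of_poly_smult pderiv_diff pderiv_smult E_def)
  have geo: "fps_of_poly [:1, - c:] * Abs_fps (\<lambda>j. c ^ j) = 1" for c :: 'a
  proof (rule fps_ext)
    fix n
    show "fps_nth (fps_of_poly [:1, - c:] * Abs_fps (\<lambda>j. c ^ j)) n = fps_nth 1 n"
      by (cases n) (simp_all add: fps_of_poly_linear' algebra_simps)
  qed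
  \<comment> \<open>\<open>S\<close> is the generating function, the sum of
    \<open>r l / (1 - r l T)\<close>. Multiplication by \<open>q\<close> cancels one linear factor
    in each summand, and what remains is the product rule for \<open>- q'\<close>.\<close>
  have "S = (\<Sum>l\<in>L. fps_const (r l) * Abs_fps (\<lambda>j. r l ^ j))"
    by (rule fps_ext) (simp add: S_def s_def r_def fps_sum_nth power_inverse)
  then have "fps_of_poly q * S = (\<Sum>l\<in>L. fps_of_poly q * (fps_const (r l) * Abs_fps (\<lambda>j. r l ^ j)))"
    by (simp add: sum_distrib_left)
  also have "\<dots> = (\<Sum>l\<in>L. fps_of_poly ((\<Prod>k\<in>L - {l}. [:1, - r k:]) * [:r l:]))"
  proof (intro sum.cong refl)
    fix l assume l: "l \<in> L"
    have "fps_of_poly q = fps_of_poly [:1, - r l:] * fps_of_poly (\<Prod>k\<in>L - {l}. [:1, - r k:])"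
      unfolding q_def using finite_L l by (subst prod.remove[of L l]) (auto simp: fps_of_poly_mult)
    then have "fps_of_poly q * (fps_const (r l) * Abs_fps (\<lambda>j. r l ^ j)) =
        (fps_of_poly [:1, - r l:] * Abs_fps (\<lambda>j. r l ^ j)) *
        (fps_of_poly (\<Prod>k\<in>L - {l}. [:1, - r k:]) * fps_const (r l))"
      by (simp only: mult_ac)
    then show "fps_of_poly q * (fps_const (r l) * Abs_fps (\<lambda>j. r l ^ j)) =
        fps_of_poly ((\<Prod>k\<in>L - {l}. [:1, - r k:]) * [:r l:])"
      by (simp only: geo fps_of_poly_mult fps_of_poly_const mult_1_left)
  qed
  also have "\<dots> = fps_of_poly (- pderiv q)"
    by (simp add: q_def pderiv_prod pderiv_pCons fps_of_poly_sum sum_negf [symmetric]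
        flip: fps_of_poly_uminus)
  finally have "fps_of_poly q * S = fps_const x"
    by (simp add: dq fps_of_poly_const)
  \<comment> \<open>Since \<open>q = 1 - x E\<close>, the equation \<open>q S = x\<close> rearranges
    to a fixed-point equation, whose coefficient at \<open>T ^ j\<close> is the recursion.\<close>
  then have "S = fps_const x * (1 + fps_of_poly E * S)"
    by (simp add: q_fps algebra_simps)
  then have "fps_nth S j = fps_nth (fps_const x * (1 + fps_of_poly E * S)) j" by simp
  moreover have "fps_nth (fps_of_poly E * S) j = (\<Sum>m=1..j. coeff E m * s (Suc j - m))"
    unfolding fps_mult_nth S_def
    by (subst sum.atLeast_Suc_atMost) (auto simp: E_def coeff_exp_poly_0 Suc_diff_le)
  ultimately show ?thesis
    by (simp add: S_def x_def E_def)
qed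

end

section \<open>Polynomial identities and power series in the reciprocal variable\<close>

lemma poly_eqI_infinite:
  fixes p q :: "'a::idom poly"
  assumes "infinite A" "\<And>x. x \<in> A \<Longrightarrow> poly p x = poly q x"
  shows "p = q"
proof -
  have "A \<subseteq> {x. poly (p - q) x = 0}" using assms(2) by auto
  then have "infinite {x. poly (p - q) x = 0}" using assms(1) finite_subset by blast
  then show ?thesis using poly_roots_finite[of "p - q"] by auto
qed

lemma poly_eq_sum_atMost:
  fixes p :: "'a::comm_ring_1 poly"
  assumes "degree p \<le> D"
  shows "poly p x = (\<Sum>i\<le>D. coeff p i * x ^ i)"
  unfolding poly_altdef using assms
  by (intro sum.mono_neutral_left) (auto simp: coeff_eq_0)

lemma poly_fps_eq_sum_atMost:
  assumes "degree p \<le> D"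
  shows "poly_fps p F = (\<Sum>i\<le>D. fps_const (coeff p i) * F ^ i)"
proof -
  have "degree (map_poly fps_const p) \<le> D"
    using assms map_poly_degree_leq[of fps_const p] by linarith
  then show ?thesis
    by (simp add: poly_fps_def poly_eq_sum_atMost coeff_map_poly)
qed

text \<open>The power series \<open>1/p(1/X)\<close>.\<close>

definition recip_fps :: "'a::field poly \<Rightarrow> 'a fps" where
  "recip_fps p = fps_X ^ degree p * inverse (fps_of_poly (reflect_poly p))"

lemma recip_fps_times_reflect:
  assumes "p \<noteq> 0"
  shows "recip_fps p * fps_of_poly (reflect_poly p) = fps_X ^ degree p"
  using assms by (simp add: recip_fps_def mult.assoc inverse_mult_eq_1)

lemma recip_fps_nth_eq_0: "k < degree p \<Longrightarrow> fps_nth (recip_fps p) k = 0"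
  by (simp add: recip_fps_def fps_X_power_mult_nth)

lemma recip_fps_neq_0: "p \<noteq> 0 \<Longrightarrow> recip_fps p \<noteq> 0"
  by (auto simp: recip_fps_def)

text \<open>Formally, \<open>1/p(r(1/X))\<close> is \<open>1/p(1/Y)\<close> at
  \<open>Y = 1/r(1/X)\<close>. As \<open>1/X\<close> is not a power series, the argument runs
  through the reflected polynomials, linked by \<open>W * Q r = X ^ degree r\<close>.\<close>

lemma recip_fps_pcompose:
  fixes p r :: "'a::field poly"
  assumes inf: "infinite (UNIV :: 'a set)" and "p \<noteq> 0" and r: "0 < degree r"
  shows "recip_fps (pcompose p r) = recip_fps p oo recip_fps r"
proof -
  define W where "W = recip_fps r"
  define Q where "Q = (\<lambda>p :: 'a poly. fps_of_poly (reflect_poly p))"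
  have W0: "fps_nth W 0 = 0"
    using r by (simp add: W_def recip_fps_nth_eq_0)
  have r0: "r \<noteq> 0" using r by auto
  have WQ: "W * Q r = fps_X ^ degree r"
    unfolding W_def Q_def using r0 by (rule recip_fps_times_reflect)
  \<comment> \<open>The polynomial form of \<open>x ^ (degree r * degree p) * p(r(1/x))\<close>,
    with every power of \<open>1/x\<close> cleared by reflecting \<open>r\<close>.\<close>
  define H where "H = (\<Sum>i\<le>degree p. smult (coeff p (degree p - i))
      (monom 1 (degree r * i) * reflect_poly r ^ (degree p - i)))"
  have "H = reflect_poly (pcompose p r)"
  proof (rule poly_eqI_infinite[of "UNIV - {0}"])
    show "infinite (UNIV - {0 :: 'a})" using inf by simp
    fix x :: 'a assume "x \<in> UNIV - {0}"
    then have x: "x \<noteq> 0" by simp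
    have "poly H x = (\<Sum>i\<le>degree p. x ^ (degree r * degree p) *
        (coeff p (degree p - i) * poly r (inverse x) ^ (degree p - i)))"
      unfolding H_def poly_sum
    proof (intro sum.cong refl)
      fix i assume "i \<in> {..degree p}"
      then have "degree r * degree p = degree r * i + degree r * (degree p - i)"
        by (simp flip: add_mult_distrib2)
      then show "poly (smult (coeff p (degree p - i))
          (monom 1 (degree r * i) * reflect_poly r ^ (degree p - i))) x =
        x ^ (degree r * degree p) * (coeff p (degree p - i) * poly r (inverse x) ^ (degree p - i))"
        using x by (simp add: poly_monom poly_reflect_poly_nz power_mult_distrib power_add
            power_mult [symmetric])
    qed
    also have "\<dots> = x ^ (degree r * degree p) *
        (\<Sum>i\<le>degree p. coeff p i * poly r (inverse x) ^ i)"
      unfolding sum_distrib_left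
      by (rule sum.reindex_bij_witness[of _ "\<lambda>i. degree p - i" "\<lambda>i. degree p - i"]) auto
    also have "\<dots> = poly (reflect_poly (pcompose p r)) x"
      using x by (simp add: poly_reflect_poly_nz degree_pcompose poly_pcompose poly_altdef[of p] mult.commute)
    finally show "poly H x = poly (reflect_poly (pcompose p r)) x" .
  qed
  then have "Q (pcompose p r) = fps_of_poly H" by (simp add: Q_def)
  \<comment> \<open>Replacing \<open>X ^ degree r\<close> by \<open>W * Q r\<close> gives each
    summand the same factor \<open>Q r ^ degree p\<close>; the rest is \<open>Q p\<close> with
    \<open>W\<close> substituted.\<close>
  also have "\<dots> = (\<Sum>i\<le>degree p. fps_const (coeff p (degree p - i)) * W ^ i * Q r ^ degree p)"
    unfolding H_def fps_of_poly_sum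
  proof (intro sum.cong refl)
    fix i assume "i \<in> {..degree p}"
    then have i: "degree p = i + (degree p - i)" by simp
    have "fps_of_poly (monom 1 (degree r * i)) = W ^ i * Q r ^ i"
      by (simp add: fps_of_poly_monom' power_mult flip: WQ power_mult_distrib)
    then show "fps_of_poly (smult (coeff p (degree p - i))
        (monom 1 (degree r * i) * reflect_poly r ^ (degree p - i))) =
      fps_const (coeff p (degree p - i)) * W ^ i * Q r ^ degree p"
      by (subst (4) i) (simp add: fps_of_poly_smult fps_of_poly_mult fps_of_poly_power power_add Q_def mult_ac)
  qed
  also have "\<dots> = (Q p oo W) * Q r ^ degree p"
  proof -
    have "reflect_poly p = (\<Sum>i\<le>degree p. monom (coeff p (degree p - i)) i)"
      by (rule poly_eqI) (auto simp: coeff_sum coeff_reflect_poly coeff_eq_0)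
    then have "Q p = (\<Sum>i\<le>degree p. fps_const (coeff p (degree p - i)) * fps_X ^ i)"
      by (simp add: Q_def fps_of_poly_sum fps_of_poly_monom)
    then show ?thesis
      using W0 by (simp add: fps_compose_sum_distrib fps_compose_mult_distrib sum_distrib_right
          flip: fps_compose_power)
  qed
  finally have "fps_of_poly (reflect_poly (pcompose p r)) = (Q p oo W) * Q r ^ degree p"
    by (simp only: Q_def)
  moreover have "fps_X ^ degree (pcompose p r) = (fps_X ^ degree r :: 'a fps) ^ degree p"
    by (simp only: degree_pcompose mult.commute[of "degree p"] power_mult)
  ultimately have "recip_fps (pcompose p r) =
      (fps_X ^ degree r) ^ degree p * (inverse (Q p oo W) * inverse (Q r) ^ degree p)"
    by (simp only: recip_fps_def fps_inverse_mult fps_inverse_power)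
  also have "\<dots> = (fps_X ^ degree r * inverse (Q r)) ^ degree p * inverse (Q p oo W)"
    by (simp only: power_mult_distrib mult_ac)
  also have "fps_X ^ degree r * inverse (Q r) = W"
    by (simp add: W_def recip_fps_def Q_def)
  also have "W ^ degree p * inverse (Q p oo W) = recip_fps p oo W"
    using W0 assms(2) unfolding recip_fps_def Q_def
    by (simp add: fps_compose_mult_distrib fps_inverse_compose flip: fps_compose_power)
  finally show ?thesis by (simp add: W_def)
qed

text \<open>An identity of values becomes one of power series by substituting \<open>1/X\<close> for \<open>y\<close>.\<close>

lemma sum_poly_fps_recip:
  fixes M Y :: "'a::field set"
  assumes M: "finite M" and Y: "infinite Y"
    and eq: "\<And>y. y \<in> Y \<Longrightarrow>
      (\<Sum>m\<in>M. poly P (inverse (y + m))) = poly R (inverse (\<Prod>m\<in>M. y + m))"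
  shows "(\<Sum>m\<in>M. poly_fps P (recip_fps [:m, 1:])) = poly_fps R (recip_fps (\<Prod>m\<in>M. [:m, 1:]))"
proof -
  define c where "c = (\<lambda>m::'a. reflect_poly [:m, 1:])"
  define E where "E = (\<Prod>m\<in>M. c m)"
  define E' where "E' = (\<lambda>m. \<Prod>m\<in>M - {m}. c m)"
  define D where "D = max (degree P) (degree R)"
  \<comment> \<open>\<open>A\<close> and \<open>B\<close> are the two sides at
    \<open>x = 1/y\<close>, multiplied by \<open>E ^ D\<close> to clear denominators:
    \<open>1/(y + m) = x / c m\<close> and \<open>E / c m = E' m\<close>.\<close>
  define A where "A = (\<Sum>m\<in>M. \<Sum>i\<le>D. smult (coeff P i) (monom 1 i * E' m ^ i * E ^ (D - i)))"
  define B where "B = (\<Sum>i\<le>D. smult (coeff R i) (monom 1 (card M * i) * E ^ (D - i)))"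
  have D: "degree P \<le> D" "degree R \<le> D" by (auto simp: D_def)
  have E: "E = c m * E' m" if "m \<in> M" for m
    unfolding E_def E'_def using M that by (rule prod.remove)
  have E_reflect: "E = reflect_poly (\<Prod>m\<in>M. [:m, 1:])"
    by (simp add: E_def c_def reflect_poly_prod)
  have deg: "degree (\<Prod>m\<in>M. [:m, 1:]) = card M"
    by (subst degree_prod_sum_eq) auto
  have nz: "(\<Prod>m\<in>M. [:m, 1:]) \<noteq> 0"
    using M by (auto simp: prod_zero_iff)
  have AB: "A = B"
  proof (rule poly_eqI_infinite[of "inverse ` (Y - {0} - uminus ` M)"])
    \<comment> \<open>The finitely many points removed are those where \<open>1/y\<close> or some
      \<open>1/(y + m)\<close> would be the default value \<open>inverse 0 = 0\<close>.\<close>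
    have "infinite (Y - {0} - uminus ` M)" using Y M by simp
    then show "infinite (inverse ` (Y - {0} - uminus ` M))"
      by (subst finite_image_iff) (auto intro: inj_onI)
    fix x assume "x \<in> inverse ` (Y - {0} - uminus ` M)"
    then obtain y where y: "y \<in> Y" "y \<noteq> 0" "y \<notin> uminus ` M" and x: "x = inverse y" by auto
    have ym: "y + m \<noteq> 0" if "m \<in> M" for m
      using that y(3) by (auto simp: add_eq_0_iff2)
    have x0: "x \<noteq> 0" using x y by simp
    have c: "x = inverse (y + m) * poly (c m) x" if "m \<in> M" for m
      using x0 ym[OF that] by (simp add: c_def poly_reflect_poly_nz x field_simps)
    have Ex: "x ^ card M = inverse (\<Prod>m\<in>M. y + m) * poly E x"
      using x0 ym M by (simp add: E_reflect poly_reflect_poly_nz deg poly_prod x prod_zero_iff add.commute)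
    have Ex0: "poly E x \<noteq> 0"
      using Ex x0 by auto
    have "poly A x = (\<Sum>m\<in>M. \<Sum>i\<le>D. poly E x ^ D * (coeff P i * inverse (y + m) ^ i))"
      unfolding A_def poly_sum
    proof (intro sum.cong refl)
      fix m i assume mi: "m \<in> M" "i \<in> {..D}"
      have "x ^ i * poly (E' m) x ^ i = inverse (y + m) ^ i * poly E x ^ i"
        by (subst c[OF mi(1)]) (simp add: E[OF mi(1)] power_mult_distrib mult_ac)
      moreover have "poly E x ^ D = poly E x ^ i * poly E x ^ (D - i)"
        using mi by (simp flip: power_add)
      ultimately show "poly (smult (coeff P i) (monom 1 i * E' m ^ i * E ^ (D - i))) x =
          poly E x ^ D * (coeff P i * inverse (y + m) ^ i)"
        by (simp add: poly_monom mult_ac)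
    qed
    also have "\<dots> = poly E x ^ D * (\<Sum>m\<in>M. poly P (inverse (y + m)))"
      by (simp add: poly_eq_sum_atMost[OF D(1)] sum_distrib_left)
    also have "\<dots> = poly E x ^ D * poly R (inverse (\<Prod>m\<in>M. y + m))"
      using eq[OF y(1)] by simp
    also have "\<dots> = (\<Sum>i\<le>D. poly E x ^ D * (coeff R i * inverse (\<Prod>m\<in>M. y + m) ^ i))"
      by (simp add: poly_eq_sum_atMost[OF D(2)] sum_distrib_left)
    also have "\<dots> = poly B x"
      unfolding B_def poly_sum
    proof (intro sum.cong refl)
      fix i assume i: "i \<in> {..D}"
      have "poly E x ^ D = poly E x ^ i * poly E x ^ (D - i)"
        using i by (simp flip: power_add)
      moreover have "x ^ (card M * i) = inverse (\<Prod>m\<in>M. y + m) ^ i * poly E x ^ i"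
        by (simp only: power_mult Ex power_mult_distrib)
      ultimately show "poly E x ^ D * (coeff R i * inverse (\<Prod>m\<in>M. y + m) ^ i) =
          poly (smult (coeff R i) (monom 1 (card M * i) * E ^ (D - i))) x"
        by (simp add: poly_monom mult_ac)
    qed
    finally show "poly A x = poly B x" .
  qed
  \<comment> \<open>The denominators are now cleared in the same way on the side of power series;
    \<open>F ^ D\<close> can be cancelled at the end because \<open>F \<noteq> 0\<close>.\<close>
  define F where "F = fps_of_poly E"
  have F0: "F \<noteq> 0"
    by (simp add: F_def E_reflect fps_of_poly_eq_iff[of _ 0, simplified] nz)
  have split: "F ^ D = F ^ i * F ^ (D - i)" if "i \<in> {..D}" for i
    using that by (simp flip: power_add)
  have "F ^ D * (\<Sum>m\<in>M. poly_fps P (recip_fps [:m, 1:])) =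
      (\<Sum>m\<in>M. \<Sum>i\<le>D. F ^ D * (fps_const (coeff P i) * recip_fps [:m, 1:] ^ i))"
    by (simp add: poly_fps_eq_sum_atMost[OF D(1)] sum_distrib_left)
  also have "\<dots> = fps_of_poly A"
    unfolding A_def fps_of_poly_sum
  proof (intro sum.cong refl)
    fix m i assume mi: "m \<in> M" "i \<in> {..D}"
    have "fps_X = recip_fps [:m, 1:] * fps_of_poly (c m)"
      using recip_fps_times_reflect[of "[:m, 1:]"] by (simp add: c_def)
    then have "fps_X ^ i = recip_fps [:m, 1:] ^ i * fps_of_poly (c m) ^ i"
      by (metis power_mult_distrib)
    then have "fps_X ^ i * fps_of_poly (E' m) ^ i = recip_fps [:m, 1:] ^ i * F ^ i"
      by (simp add: F_def E[OF mi(1)] fps_of_poly_mult power_mult_distrib mult_ac)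
    then show "F ^ D * (fps_const (coeff P i) * recip_fps [:m, 1:] ^ i) =
        fps_of_poly (smult (coeff P i) (monom 1 i * E' m ^ i * E ^ (D - i)))"
      unfolding split[OF mi(2)]
      by (simp add: F_def fps_of_poly_smult fps_of_poly_mult fps_of_poly_power fps_of_poly_monom' mult_ac)
  qed
  also have "\<dots> = (\<Sum>i\<le>D. F ^ D * (fps_const (coeff R i) * recip_fps (\<Prod>m\<in>M. [:m, 1:]) ^ i))"
    unfolding AB B_def fps_of_poly_sum
  proof (intro sum.cong refl)
    fix i assume i: "i \<in> {..D}"
    have "fps_X ^ (card M * i) = recip_fps (\<Prod>m\<in>M. [:m, 1:]) ^ i * F ^ i"
      using recip_fps_times_reflect[OF nz]
      by (simp add: F_def E_reflect deg power_mult flip: power_mult_distrib)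
    then show "fps_of_poly (smult (coeff R i) (monom 1 (card M * i) * E ^ (D - i))) =
        F ^ D * (fps_const (coeff R i) * recip_fps (\<Prod>m\<in>M. [:m, 1:]) ^ i)"
      unfolding split[OF i]
      by (simp add: F_def fps_of_poly_smult fps_of_poly_mult fps_of_poly_power fps_of_poly_monom' mult_ac)
  qed
  also have "\<dots> = F ^ D * poly_fps R (recip_fps (\<Prod>m\<in>M. [:m, 1:]))"
    by (simp add: poly_fps_eq_sum_atMost[OF D(2)] sum_distrib_left)
  finally show ?thesis using F0 by simp
qed

text \<open>In the topology of power series, convergence means that each coefficient is eventually
  constant. Finiteness at every index \<open>k\<close> makes the sum exist; a single coefficient may
  then be computed over any finite \<open>S\<close> that covers its nonzero terms.\<close>

lemma fps_infsum_nth: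
  fixes f :: "'i \<Rightarrow> 'a::ab_group_add fps"
  assumes fin: "\<And>k. finite {i \<in> I. fps_nth (f i) k \<noteq> 0}"
    and S: "finite S" "S \<subseteq> I" "\<And>i. i \<in> I \<Longrightarrow> fps_nth (f i) k \<noteq> 0 \<Longrightarrow> i \<in> S"
  shows "fps_nth (infsum f I) k = (\<Sum>i\<in>S. fps_nth (f i) k)"
proof -
  define s where "s = Abs_fps (\<lambda>k. \<Sum>i | i \<in> I \<and> fps_nth (f i) k \<noteq> 0. fps_nth (f i) k)"
  have "(f has_sum s) I"
    unfolding has_sum_def
  proof (rule tendsto_fpsI)
    fix k
    show "\<forall>\<^sub>F S in finite_subsets_at_top I. fps_nth (sum f S) k = fps_nth s k"
      unfolding eventually_finite_subsets_at_top
    proof (intro exI[of _ "{i \<in> I. fps_nth (f i) k \<noteq> 0}"] conjI allI impI)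
      fix S assume "finite S \<and> {i \<in> I. fps_nth (f i) k \<noteq> 0} \<subseteq> S \<and> S \<subseteq> I"
      then show "fps_nth (sum f S) k = fps_nth s k"
        by (auto simp: s_def fps_sum_nth intro!: sum.mono_neutral_right)
    qed (use fin in auto)
  qed
  then have "fps_nth (infsum f I) k = fps_nth s k"
    by (simp add: infsumI)
  also have "\<dots> = (\<Sum>i\<in>S. fps_nth (f i) k)"
    using S by (auto simp: s_def intro!: sum.mono_neutral_left)
  finally show ?thesis .
qed

section \<open>Analysis in the completion\<close>

context C_infty
begin

section \<open>The ultrametric absolute value\<close>

abbreviation nrm :: "'c \<Rightarrow> real" where
  "nrm x \<equiv> dist 0 x"

lemma dist_eq_nrm: "dist x y = nrm (y - x)"
  using dist_translate[of x "- x" y] by simp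

lemma nrm_1 [simp]: "nrm 1 = 1"
  using dist_mult[of 1 1] by simp

lemma nrm_minus [simp]: "nrm (- x) = nrm x"
proof -
  have "nrm (- 1) ^ 2 = 1"
    using dist_mult[of "- 1" "- 1"] by (simp add: power2_eq_square)
  then have "nrm (- 1) = 1"
    using zero_le_dist[of 0 "- 1 :: 'c"] by (simp add: power2_eq_1_iff)
  then show ?thesis using dist_mult[of "- 1" x] by simp
qed

lemma nrm_minus_commute: "nrm (x - y) = nrm (y - x)"
  using nrm_minus[of "x - y"] by simp

lemma nrm_add_le: "nrm (x + y) \<le> max (nrm x) (nrm y)"
  using dist_ultrametric[of 0 "x + y" x] by (simp add: dist_eq_nrm[of x])

lemma nrm_diff_le: "nrm (x - y) \<le> max (nrm x) (nrm y)"
  using nrm_add_le[of x "- y"] by simp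

text \<open>For the lower bound, the ultrametric inequality is applied to
  \<open>x = (x + y) - y\<close>.\<close>

lemma nrm_add_eq:
  assumes "nrm y < nrm x"
  shows "nrm (x + y) = nrm x" "nrm (y + x) = nrm x"
proof -
  show "nrm (x + y) = nrm x"
    using nrm_add_le[of x y] nrm_diff_le[of "x + y" y] assms by auto
  then show "nrm (y + x) = nrm x" by (simp add: add.commute)
qed

lemma nrm_power: "nrm (x ^ n) = nrm x ^ n"
  by (induction n) (simp_all add: dist_mult)

lemma nrm_inverse: "nrm (inverse x) = inverse (nrm x)"
proof (cases "x = 0")
  case False
  then have "nrm x * nrm (inverse x) = 1" by (simp flip: dist_mult)
  then show ?thesis by (metis inverse_unique)
qed simp

lemma nrm_prod: "nrm (prod f S) = (\<Prod>i\<in>S. nrm (f i))"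
  by (induction S rule: infinite_finite_induct) (simp_all add: dist_mult)

lemma nrm_sum_le: "0 \<le> B \<Longrightarrow> (\<And>i. i \<in> S \<Longrightarrow> nrm (f i) \<le> B) \<Longrightarrow> nrm (sum f S) \<le> B"
proof (induction S rule: infinite_finite_induct)
  case (insert x S)
  then show ?case using nrm_add_le[of "f x" "sum f S"] by fastforce
qed simp_all

section \<open>Limits, infinite sums and infinite products\<close>

lemma tendsto_iff_nrm: "(f \<longlongrightarrow> l) F \<longleftrightarrow> ((\<lambda>x. nrm (f x - l)) \<longlongrightarrow> 0) F"
  by (subst tendsto_dist_iff) (simp add: dist_eq_nrm[of _ l] nrm_minus_commute)

text \<open>The sort of \<open>'c\<close> provides a field and a complete metric without linking
  them, so the limit laws are derived from the locale assumptions on \<open>dist\<close>.\<close>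

lemma lim_add:
  assumes "(f \<longlongrightarrow> a) F" "(g \<longlongrightarrow> (b::'c)) F"
  shows "((\<lambda>x. f x + g x) \<longlongrightarrow> a + b) F"
  unfolding tendsto_iff_nrm
proof (rule tendsto_sandwich[where f = "\<lambda>_. 0" and h = "\<lambda>x. max (nrm (f x - a)) (nrm (g x - b))"])
  show "\<forall>\<^sub>F x in F. nrm (f x + g x - (a + b)) \<le> max (nrm (f x - a)) (nrm (g x - b))"
    using nrm_add_le[of "f _ - a" "g _ - b"] by (simp add: algebra_simps)
  show "((\<lambda>x. max (nrm (f x - a)) (nrm (g x - b))) \<longlongrightarrow> 0) F"
    using tendsto_max[OF assms[unfolded tendsto_iff_nrm]] by simp
qed auto

lemma lim_mult:
  assumes "(f \<longlongrightarrow> a) F" "(g \<longlongrightarrow> (b::'c)) F"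
  shows "((\<lambda>x. f x * g x) \<longlongrightarrow> a * b) F"
  unfolding tendsto_iff_nrm
proof (rule tendsto_sandwich[where f = "\<lambda>_. 0"
      and h = "\<lambda>x. max (nrm (f x - a) * nrm (g x)) (nrm a * nrm (g x - b))"])
  have "nrm (f x * g x - a * b) \<le> max (nrm (f x - a) * nrm (g x)) (nrm a * nrm (g x - b))" for x
    using nrm_add_le[of "(f x - a) * g x" "a * (g x - b)"]
    by (simp add: algebra_simps flip: dist_mult)
  then show "\<forall>\<^sub>F x in F. nrm (f x * g x - a * b) \<le> max (nrm (f x - a) * nrm (g x)) (nrm a * nrm (g x - b))"
    by simp
  have "((\<lambda>x. nrm (g x)) \<longlongrightarrow> nrm b) F"
    using assms(2) by (intro tendsto_intros)
  then show "((\<lambda>x. max (nrm (f x - a) * nrm (g x)) (nrm a * nrm (g x - b))) \<longlongrightarrow> 0) F"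
    using tendsto_max[OF tendsto_mult[OF assms(1)[unfolded tendsto_iff_nrm]]
        tendsto_mult[OF tendsto_const[of "nrm a"] assms(2)[unfolded tendsto_iff_nrm]]] by simp
qed auto

lemma lim_diff:
  assumes "(f \<longlongrightarrow> a) F" "(g \<longlongrightarrow> (b::'c)) F"
  shows "((\<lambda>x. f x - g x) \<longlongrightarrow> a - b) F"
  using lim_add[OF assms(1) lim_mult[OF tendsto_const[of "- 1"] assms(2)]] by simp

lemma lim_sum:
  "(\<And>i. i \<in> S \<Longrightarrow> ((\<lambda>x. f i x) \<longlongrightarrow> (l i :: 'c)) F) \<Longrightarrow>
    ((\<lambda>x. \<Sum>i\<in>S. f i x) \<longlongrightarrow> (\<Sum>i\<in>S. l i)) F"
  by (induction S rule: infinite_finite_induct) (auto intro: lim_add)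

text \<open>The Cauchy criterion for nets over finite subsets: completeness is applied to a sequence
  of finite sets, and its limit is shown to be the limit of the whole net.\<close>

lemma finite_subsets_convergent:
  fixes \<phi> :: "'i set \<Rightarrow> 'c"
  assumes "\<And>\<epsilon>. 0 < \<epsilon> \<Longrightarrow> \<exists>X\<subseteq>I. finite X \<and>
    (\<forall>Y. finite Y \<and> X \<subseteq> Y \<and> Y \<subseteq> I \<longrightarrow> nrm (\<phi> Y - \<phi> X) \<le> \<epsilon>)"
  shows "\<exists>l. (\<phi> \<longlongrightarrow> l) (finite_subsets_at_top I)"
proof -
  define \<epsilon> where "\<epsilon> = (\<lambda>k. inverse (real (Suc k)))"
  have eps: "0 < \<epsilon> k" for k by (simp add: \<epsilon>_def)
  obtain X where X: "\<And>k. X k \<subseteq> I" "\<And>k. finite (X k)"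
    "\<And>k Y. finite Y \<Longrightarrow> X k \<subseteq> Y \<Longrightarrow> Y \<subseteq> I \<Longrightarrow> nrm (\<phi> Y - \<phi> (X k)) \<le> \<epsilon> k"
    using assms[OF eps] by metis
  \<comment> \<open>The sets \<open>X k\<close> need not increase, but their unions do, and
    \<open>G m\<close> contains \<open>X k\<close> for every \<open>k \<le> m\<close>.\<close>
  define G where "G = (\<lambda>k. \<Union>i\<le>k. X i)"
  have G: "finite (G k)" "G k \<subseteq> I" for k
    using X by (auto simp: G_def)
  have XG: "nrm (\<phi> (G m) - \<phi> (X k)) \<le> \<epsilon> k" if "k \<le> m" for k m
    using X(3)[OF G(1) _ G(2), of k m] that by (auto simp: G_def)
  have "Cauchy (\<lambda>k. \<phi> (G k))"
  proof (rule metric_CauchyI)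
    fix e :: real assume "0 < e"
    then obtain k where k: "\<epsilon> k < e"
      unfolding \<epsilon>_def using reals_Archimedean by blast
    have "dist (\<phi> (G m)) (\<phi> (G n)) < e" if "k \<le> m" "k \<le> n" for m n
      using nrm_diff_le[of "\<phi> (G n) - \<phi> (X k)" "\<phi> (G m) - \<phi> (X k)"]
        XG[OF that(1)] XG[OF that(2)] k by (simp add: dist_eq_nrm[of "\<phi> (G m)"])
    then show "\<exists>M. \<forall>m\<ge>M. \<forall>n\<ge>M. dist (\<phi> (G m)) (\<phi> (G n)) < e" by blast
  qed
  then obtain l where l: "(\<lambda>k. \<phi> (G k)) \<longlonglongrightarrow> l"
    using Cauchy_convergent unfolding convergent_def by blast
  have "(\<phi> \<longlongrightarrow> l) (finite_subsets_at_top I)"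
    unfolding tendsto_iff_nrm
  proof (rule order_tendstoI)
    fix e :: real assume "e < 0"
    then show "\<forall>\<^sub>F Y in finite_subsets_at_top I. e < nrm (\<phi> Y - l)"
      by (intro always_eventually allI less_le_trans[OF _ zero_le_dist])
  next
    fix e :: real assume e: "0 < e"
    then obtain k where k: "\<epsilon> k < e"
      unfolding \<epsilon>_def using reals_Archimedean by blast
    have "\<forall>\<^sub>F m in sequentially. nrm (\<phi> (G m) - l) < e"
      using l e unfolding tendsto_iff_nrm by (intro order_tendstoD(2))
    then obtain m where m: "k \<le> m" "nrm (\<phi> (G m) - l) < e"
      unfolding eventually_sequentially by (meson le_cases order.trans)
    have "nrm (\<phi> Y - l) < e" if "finite Y" "X k \<subseteq> Y" "Y \<subseteq> I" for Y
      using X(3)[OF that] XG[OF m(1)] m(2) k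
        nrm_diff_le[of "\<phi> Y - \<phi> (X k)" "\<phi> (G m) - \<phi> (X k)"]
        nrm_add_le[of "\<phi> Y - \<phi> (G m)" "\<phi> (G m) - l"] by simp
    then show "\<forall>\<^sub>F Y in finite_subsets_at_top I. nrm (\<phi> Y - l) < e"
      unfolding eventually_finite_subsets_at_top by (intro exI[of _ "X k"]) (simp add: X)
  qed
  then show ?thesis by blast
qed

text \<open>In an ultrametric field a sum over a tail is bounded by its largest term, so terms
  tending to 0 suffice.\<close>

lemma has_sum_exists:
  fixes f :: "'i \<Rightarrow> 'c"
  assumes "\<And>\<epsilon>. 0 < \<epsilon> \<Longrightarrow> finite {i \<in> I. \<epsilon> < nrm (f i)}"
  shows "\<exists>s. (f has_sum s) I"
  unfolding has_sum_def
proof (rule finite_subsets_convergent)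
  fix \<epsilon> :: real assume e: "0 < \<epsilon>"
  show "\<exists>X\<subseteq>I. finite X \<and> (\<forall>Y. finite Y \<and> X \<subseteq> Y \<and> Y \<subseteq> I \<longrightarrow> nrm (sum f Y - sum f X) \<le> \<epsilon>)"
  proof (intro exI[of _ "{i \<in> I. \<epsilon> < nrm (f i)}"] conjI allI impI)
    fix Y assume Y: "finite Y \<and> {i \<in> I. \<epsilon> < nrm (f i)} \<subseteq> Y \<and> Y \<subseteq> I"
    then have "sum f Y - sum f {i \<in> I. \<epsilon> < nrm (f i)} = sum f (Y - {i \<in> I. \<epsilon> < nrm (f i)})"
      by (simp add: sum_diff)
    then show "nrm (sum f Y - sum f {i \<in> I. \<epsilon> < nrm (f i)}) \<le> \<epsilon>"
      using e Y by (auto intro!: nrm_sum_le)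
  qed (use assms[OF e] in auto)
qed

text \<open>A factor \<open>1 + f i\<close> has absolute value 1, so it preserves the distance of
  the old product from 1, and adding \<open>f i\<close> keeps the bound by the ultrametric
  inequality.\<close>

lemma nrm_prod_minus_1_le:
  assumes "finite S" "0 \<le> \<delta>" "\<delta> < 1" "\<And>i. i \<in> S \<Longrightarrow> nrm (f i) \<le> \<delta>"
  shows "nrm ((\<Prod>i\<in>S. 1 + f i) - 1) \<le> \<delta>"
  using assms(1,4)
proof (induction S)
  case (insert i S)
  have "(\<Prod>i\<in>insert i S. 1 + f i) - 1 = (1 + f i) * ((\<Prod>i\<in>S. 1 + f i) - 1) + f i"
    using insert.hyps by (simp add: algebra_simps)
  moreover have "nrm (1 + f i) = 1"
    using insert.prems[of i] assms(3) by (subst nrm_add_eq(1)) auto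
  ultimately show ?case
    using nrm_add_le[of "(1 + f i) * ((\<Prod>i\<in>S. 1 + f i) - 1)" "f i"] insert
    by (fastforce simp: dist_mult)
qed (use assms(2) in simp)

lemma prod_convergent:
  fixes f :: "'i \<Rightarrow> 'c"
  assumes fin: "\<And>\<epsilon>. 0 < \<epsilon> \<Longrightarrow> finite {i \<in> I. \<epsilon> < nrm (f i)}"
  shows "\<exists>l. ((\<lambda>S. \<Prod>i\<in>S. 1 + f i) \<longlongrightarrow> l) (finite_subsets_at_top I)"
proof (rule finite_subsets_convergent)
  fix \<epsilon> :: real assume e: "0 < \<epsilon>"
  \<comment> \<open>Outside the finite set \<open>X0\<close> all factors have absolute value 1, so
    every finite product over a set containing \<open>X0\<close> has absolute value
    \<open>M\<close>.\<close>
  define X0 where "X0 = {i \<in> I. 1/2 < nrm (f i)}"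
  define M where "M = nrm (\<Prod>i\<in>X0. 1 + f i)"
  have M: "0 \<le> M" by (simp add: M_def)
  \<comment> \<open>The second entry gives \<open>M * \<delta> \<le> \<epsilon>\<close>, with
    \<open>M + 1\<close> because \<open>M\<close> may be 0. The bound 1/2 gives
    \<open>X0 \<subseteq> X\<close> and \<open>\<delta> < 1\<close>.\<close>
  define \<delta> where "\<delta> = min (1/2) (\<epsilon> / (M + 1))"
  have d: "0 < \<delta>" "\<delta> \<le> 1/2" "M * \<delta> \<le> \<epsilon>"
  proof -
    show "0 < \<delta>" using e M by (simp add: \<delta>_def)
    show "\<delta> \<le> 1/2" unfolding \<delta>_def by (rule min.cobounded1)
    have "M * \<delta> \<le> M * (\<epsilon> / (M + 1))"
      using M by (intro mult_left_mono) (auto simp: \<delta>_def)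
    also have "\<dots> \<le> \<epsilon>" using M e by (simp add: field_simps)
    finally show "M * \<delta> \<le> \<epsilon>" .
  qed
  define X where "X = {i \<in> I. \<delta> < nrm (f i)}"
  have X: "finite X" "X0 \<subseteq> X" "X \<subseteq> I"
    using fin[OF d(1)] d(2) by (auto simp: X_def X0_def)
  have "(\<Prod>i\<in>X. 1 + f i) = (\<Prod>i\<in>X0. 1 + f i) * (\<Prod>i\<in>X - X0. 1 + f i)"
    using X by (simp add: prod.subset_diff mult.commute)
  moreover have "nrm (\<Prod>i\<in>X - X0. 1 + f i) = 1"
    unfolding nrm_prod
  proof (intro prod.neutral ballI)
    fix i assume "i \<in> X - X0"
    then have "nrm (f i) < nrm 1" by (auto simp: X_def X0_def)
    then show "nrm (1 + f i) = 1" by (subst nrm_add_eq(1)) auto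
  qed
  ultimately have PX: "nrm (\<Prod>i\<in>X. 1 + f i) = M"
    by (simp add: M_def dist_mult)
  show "\<exists>X\<subseteq>I. finite X \<and> (\<forall>Y. finite Y \<and> X \<subseteq> Y \<and> Y \<subseteq> I \<longrightarrow>
      nrm ((\<Prod>i\<in>Y. 1 + f i) - (\<Prod>i\<in>X. 1 + f i)) \<le> \<epsilon>)"
  proof (intro exI[of _ X] conjI allI impI)
    fix Y assume Y: "finite Y \<and> X \<subseteq> Y \<and> Y \<subseteq> I"
    then have "(\<Prod>i\<in>Y. 1 + f i) = (\<Prod>i\<in>Y - X. 1 + f i) * (\<Prod>i\<in>X. 1 + f i)"
      by (intro prod.subset_diff) auto
    then have "(\<Prod>i\<in>Y. 1 + f i) - (\<Prod>i\<in>X. 1 + f i) =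
        (\<Prod>i\<in>X. 1 + f i) * ((\<Prod>i\<in>Y - X. 1 + f i) - 1)"
      by (simp add: algebra_simps)
    moreover have "nrm ((\<Prod>i\<in>Y - X. 1 + f i) - 1) \<le> \<delta>"
      using d Y by (intro nrm_prod_minus_1_le) (auto simp: X_def)
    ultimately have "nrm ((\<Prod>i\<in>Y. 1 + f i) - (\<Prod>i\<in>X. 1 + f i)) \<le> M * \<delta>"
      using M by (simp add: dist_mult PX mult_left_mono)
    then show "nrm ((\<Prod>i\<in>Y. 1 + f i) - (\<Prod>i\<in>X. 1 + f i)) \<le> \<epsilon>" using d by simp
  qed (use X in auto)
qed

section \<open>Power series evaluated at points\<close>

lemma sums_exists:
  fixes f :: "nat \<Rightarrow> 'c"
  assumes "(\<lambda>n. nrm (f n)) \<longlonglongrightarrow> 0"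
  shows "\<exists>s. f sums s"
proof -
  have "\<exists>s. (f has_sum s) UNIV"
  proof (rule has_sum_exists)
    fix \<epsilon> :: real assume "0 < \<epsilon>"
    then have "\<forall>\<^sub>F n in sequentially. nrm (f n) < \<epsilon>"
      by (rule order_tendstoD(2)[OF assms])
    then have "finite {n. \<not> nrm (f n) < \<epsilon>}"
      by (simp add: eventually_cofinite flip: cofinite_eq_sequentially)
    then show "finite {i \<in> UNIV. \<epsilon> < nrm (f i)}"
      by (rule rev_finite_subset) auto
  qed
  then show ?thesis
    unfolding has_sum_def sums_def
    using filterlim_compose[OF _ filterlim_lessThan_at_top] by blast
qed

lemma sums_nrm_bounded:
  assumes "f sums (s :: 'c)"
  shows "\<exists>B>0. \<forall>n. nrm (f n) \<le> B"
proof -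
  have "(\<lambda>n. sum f {..<Suc n} - sum f {..<n}) \<longlonglongrightarrow> s - s"
    using assms unfolding sums_def by (intro lim_diff LIMSEQ_Suc)
  then have "(\<lambda>n. nrm (f n)) \<longlonglongrightarrow> 0"
    unfolding tendsto_iff_nrm by simp
  then have "Bseq (\<lambda>n. nrm (f n))"
    by (intro convergent_imp_Bseq) (auto simp: convergent_def)
  then show ?thesis
    by (auto simp: Bseq_def)
qed

lemma fps_of_poly_mult_sums:
  assumes "(\<lambda>n. fps_nth a n * t ^ n) sums (s :: 'c)"
  shows "(\<lambda>n. fps_nth (fps_of_poly p * a) n * t ^ n) sums (poly p t * s)"
proof (induction p)
  case (pCons c p)
  have "fps_of_poly (pCons c p) * a = fps_const c * a + fps_X * (fps_of_poly p * a)"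
    by (simp add: fps_of_poly_pCons algebra_simps)
  moreover have "(\<lambda>n. fps_nth (fps_X * (fps_of_poly p * a)) n * t ^ n) sums (t * (poly p t * s))"
    unfolding sums_def
  proof (rule LIMSEQ_offset[of _ 1])
    have "(\<Sum>i<n + 1. fps_nth (fps_X * (fps_of_poly p * a)) i * t ^ i) =
        t * (\<Sum>i<n. fps_nth (fps_of_poly p * a) i * t ^ i)" for n
      by (simp add: sum.lessThan_Suc_shift sum_distrib_left mult_ac del: sum.lessThan_Suc)
    then show "(\<lambda>n. \<Sum>i<n + 1. fps_nth (fps_X * (fps_of_poly p * a)) i * t ^ i) \<longlonglongrightarrow> t * (poly p t * s)"
      using pCons.IH unfolding sums_def by (simp add: lim_mult)
  qed
  moreover have "(\<lambda>n. c * (fps_nth a n * t ^ n)) sums (c * s)"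
    using lim_mult[OF tendsto_const[of c] assms[unfolded sums_def]]
    by (simp add: sums_def sum_distrib_left)
  ultimately show ?case
    unfolding sums_def by (auto simp: algebra_simps sum.distrib dest: lim_add)
qed (simp add: sums_def)

text \<open>Zeros are isolated: near 0 the lowest nonzero term strictly dominates all others, so the
  value cannot vanish there.\<close>

lemma fps_eq_0_if_sums_0:
  fixes D :: "'c fps"
  assumes "\<And>\<epsilon>. 0 < \<epsilon> \<Longrightarrow> \<exists>t. t \<noteq> 0 \<and> nrm t < \<epsilon> \<and> (\<lambda>n. fps_nth D n * t ^ n) sums 0"
  shows "D = 0"
proof (rule ccontr)
  assume D: "D \<noteq> 0"
  define m where "m = subdegree D"
  define c where "c = fps_nth D m"
  have c: "c \<noteq> 0" using D by (simp add: c_def m_def)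
  obtain v where v: "v \<noteq> 0" "(\<lambda>n. fps_nth D n * v ^ n) sums 0"
    using assms[of 1] by auto
  obtain B where B: "0 < B" "\<And>n. nrm (fps_nth D n * v ^ n) \<le> B"
    using sums_nrm_bounded[OF v(2)] by blast
  \<comment> \<open>Convergence at \<open>v\<close> bounds each later term at \<open>t\<close> by
    \<open>B * (nrm t / nrm v) ^ Suc m\<close>; the second entry makes this smaller than
    \<open>nrm (c * t ^ m)\<close>.\<close>
  define \<epsilon> where "\<epsilon> = min (nrm v) (nrm c * nrm v ^ Suc m / B)"
  have "0 < \<epsilon>" using v c B by (simp add: \<epsilon>_def)
  then obtain t where t: "t \<noteq> 0" "nrm t < \<epsilon>" "(\<lambda>n. fps_nth D n * t ^ n) sums 0"
    using assms by blast
  define \<rho> where "\<rho> = nrm t / nrm v"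
  have \<rho>: "0 \<le> \<rho>" "\<rho> \<le> 1" using t v by (auto simp: \<rho>_def \<epsilon>_def)
  have tail: "nrm (fps_nth D n * t ^ n) \<le> B * \<rho> ^ Suc m" if "m < n" for n
  proof -
    have "nrm (fps_nth D n * t ^ n) = nrm (fps_nth D n * v ^ n) * \<rho> ^ n"
      using v by (simp add: dist_mult nrm_power \<rho>_def power_divide)
    also have "\<dots> \<le> B * \<rho> ^ Suc m"
      using B \<rho> that by (intro mult_mono power_decreasing) auto
    finally show ?thesis .
  qed
  have small: "B * \<rho> ^ Suc m < nrm (c * t ^ m)"
  proof -
    have "nrm t * B < nrm c * nrm v ^ Suc m"
      using t(2) B(1) by (simp add: \<epsilon>_def field_simps)
    then have "nrm t ^ m * (nrm t * B) < nrm t ^ m * (nrm c * nrm v ^ Suc m)"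
      using t(1) by (intro mult_strict_left_mono) auto
    then show ?thesis
      using v(1) by (simp add: \<rho>_def power_divide dist_mult nrm_power field_simps)
  qed
  have "nrm (\<Sum>n<N. fps_nth D n * t ^ n) = nrm (c * t ^ m)" if N: "m < N" for N
  proof -
    have "(\<Sum>n<N. fps_nth D n * t ^ n) = c * t ^ m + (\<Sum>n\<in>{..<N} - {m}. fps_nth D n * t ^ n)"
      using N by (subst sum.remove[of _ m]) (auto simp: c_def)
    moreover have "nrm (\<Sum>n\<in>{..<N} - {m}. fps_nth D n * t ^ n) \<le> B * \<rho> ^ Suc m"
    proof (rule nrm_sum_le)
      fix n assume n: "n \<in> {..<N} - {m}"
      show "nrm (fps_nth D n * t ^ n) \<le> B * \<rho> ^ Suc m"
      proof (cases "n < m")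
        case True
        then have "fps_nth D n = 0" unfolding m_def by (rule nth_less_subdegree_zero)
        then show ?thesis using B \<rho> by simp
      qed (use n tail in auto)
    qed (use B \<rho> in simp)
    ultimately show ?thesis using small by (simp add: nrm_add_eq)
  qed
  then have "(\<lambda>N. nrm (\<Sum>n<N. fps_nth D n * t ^ n)) \<longlonglongrightarrow> nrm (c * t ^ m)"
    by (intro tendsto_eventually eventually_sequentiallyI[of "Suc m"]) auto
  moreover have "(\<lambda>N. nrm (\<Sum>n<N. fps_nth D n * t ^ n)) \<longlonglongrightarrow> 0"
    using t(3) unfolding sums_def tendsto_iff_nrm by simp
  ultimately have "nrm (c * t ^ m) = 0" by (rule LIMSEQ_unique)
  then show False using c t by simp
qed

text \<open>As \<open>Q\<close> has constant term 1, the coefficients of \<open>1/Q\<close> satisfy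
  a recursion that bounds them by powers of a constant \<open>B\<close>. The series thus converges
  for \<open>nrm t < 1 / B\<close>, and multiplying it by \<open>Q\<close> identifies its
  value.\<close>

lemma recip_fps_sums:
  fixes p :: "'c poly"
  assumes "lead_coeff p = 1"
  shows "\<exists>r>0. \<forall>t. t \<noteq> 0 \<and> nrm t < r \<longrightarrow>
    (\<lambda>n. fps_nth (recip_fps p) n * t ^ n) sums inverse (poly p (inverse t))"
proof -
  define Q where "Q = reflect_poly p"
  define v where "v = inverse (fps_of_poly Q)"
  have p: "p \<noteq> 0" using assms by auto
  have Q0: "coeff Q 0 = 1" using assms by (simp add: Q_def)
  have Qv: "fps_of_poly Q * v = 1"
    unfolding v_def using Q0 by (intro inverse_mult_eq_1') simp
  \<comment> \<open>\<open>1 \<le> B\<close> is required so that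
    \<open>B * B ^ (n - i) \<le> B ^ n\<close> for all \<open>i \<ge> 1\<close>.\<close>
  obtain B where B: "1 \<le> B" "\<And>i. nrm (coeff Q i) \<le> B"
  proof
    define M where "M = Max (insert 1 ((\<lambda>i. nrm (coeff Q i)) ` {..degree Q}))"
    show "1 \<le> M" by (simp add: M_def)
    show "nrm (coeff Q i) \<le> M" for i
    proof (cases "i \<le> degree Q")
      case True
      then show ?thesis unfolding M_def by (intro Max_ge) auto
    next
      case False
      then show ?thesis using \<open>1 \<le> M\<close> by (simp add: coeff_eq_0)
    qed
  qed
  have v_le: "nrm (fps_nth v n) \<le> B ^ n" for n
  proof (induction n rule: less_induct)
    case (less n)
    show ?case
    proof (cases "n = 0")
      case True
      then show ?thesis using Q0 by (simp add: v_def)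
    next
      case False
      have "0 = fps_nth (fps_of_poly Q * v) n" using False by (simp add: Qv)
      also have "\<dots> = fps_nth v n + (\<Sum>i=1..n. coeff Q i * fps_nth v (n - i))"
        unfolding fps_mult_nth using Q0 by (simp add: sum.atLeast_Suc_atMost)
      finally have "fps_nth v n = - (\<Sum>i=1..n. coeff Q i * fps_nth v (n - i))"
        by (simp add: add_eq_0_iff2)
      moreover have "nrm (\<Sum>i=1..n. coeff Q i * fps_nth v (n - i)) \<le> B ^ n"
      proof (rule nrm_sum_le)
        fix i assume i: "i \<in> {1..n}"
        have "nrm (coeff Q i * fps_nth v (n - i)) \<le> B * B ^ (n - i)"
          using B less.IH[of "n - i"] i by (auto simp: dist_mult intro!: mult_mono)
        also have "\<dots> \<le> B ^ n"
          using B i by (simp flip: power_Suc) (intro power_increasing, auto)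
        finally show "nrm (coeff Q i * fps_nth v (n - i)) \<le> B ^ n" .
      qed (use B in simp)
      ultimately show ?thesis by simp
    qed
  qed
  show ?thesis
  proof (intro exI[of _ "1 / B"] conjI allI impI)
    fix t assume t: "t \<noteq> 0 \<and> nrm t < 1 / B"
    have "(\<lambda>n. nrm (fps_nth v n * t ^ n)) \<longlonglongrightarrow> 0"
    proof (rule tendsto_sandwich[where f = "\<lambda>_. 0" and h = "\<lambda>n. (B * nrm t) ^ n"])
      show "\<forall>\<^sub>F n in sequentially. nrm (fps_nth v n * t ^ n) \<le> (B * nrm t) ^ n"
        by (intro always_eventually allI)
          (simp add: dist_mult nrm_power power_mult_distrib v_le mult_right_mono)
      show "(\<lambda>n. (B * nrm t) ^ n) \<longlonglongrightarrow> 0"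
        using t B by (intro LIMSEQ_realpow_zero) (auto simp: field_simps)
    qed auto
    then obtain s where s: "(\<lambda>n. fps_nth v n * t ^ n) sums s"
      using sums_exists[of "\<lambda>n. fps_nth v n * t ^ n"] by blast
    have "(\<lambda>n. fps_nth (fps_of_poly Q * v) n * t ^ n) sums (poly Q t * s)"
      using s by (rule fps_of_poly_mult_sums)
    moreover have "(\<lambda>n. fps_nth (fps_of_poly Q * v) n * t ^ n) sums 1"
      unfolding sums_def
    proof (intro tendsto_eventually eventually_sequentiallyI[of 1])
      fix n :: nat assume "1 \<le> n"
      then show "(\<Sum>i<n. fps_nth (fps_of_poly Q * v) i * t ^ i) = 1"
        by (subst sum.remove[of _ 0]) (auto simp: Qv intro!: sum.neutral)
    qed
    ultimately have 1: "poly Q t * s = 1"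
      unfolding sums_def by (rule LIMSEQ_unique)
    have "fps_of_poly (monom 1 (degree p)) * v = recip_fps p"
      by (simp add: recip_fps_def fps_of_poly_monom' v_def Q_def)
    then have "(\<lambda>n. fps_nth (recip_fps p) n * t ^ n) sums (t ^ degree p * s)"
      using fps_of_poly_mult_sums[OF s, of "monom 1 (degree p)"] by (simp add: poly_monom)
    moreover have "poly p (inverse t) * (t ^ degree p * s) = 1"
      using 1 t by (simp add: Q_def poly_reflect_poly_nz mult_ac)
    then have "t ^ degree p * s = inverse (poly p (inverse t))"
      by (metis inverse_unique)
    ultimately show "(\<lambda>n. fps_nth (recip_fps p) n * t ^ n) sums inverse (poly p (inverse t))"
      by simp
  qed (use B in simp)
qed

text \<open>Resolves the \<open>THE\<close> in \<open>goss_poly\<close>: any other candidate takes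
  the same values at the infinitely many points \<open>1/e(z)\<close>, because sums are
  unique.\<close>

lemma goss_poly_eqI:
  fixes L :: "'c set"
  assumes "\<beta> 1 = 1" "0 < j" "infinite (lattice_exp L ` (- L))"
    and "\<And>z. z \<notin> L \<Longrightarrow>
      ((\<lambda>w. inverse ((z + w) ^ j)) has_sum poly (goss \<beta> j) (inverse (lattice_exp L z))) L"
  shows "goss_poly j L = goss \<beta> j"
  unfolding goss_poly_def
proof (rule the_equality)
  show "lead_coeff (goss \<beta> j) = 1 \<and> degree (goss \<beta> j) = j \<and> (\<forall>z. z \<notin> L \<longrightarrow>
      ((\<lambda>w. inverse ((z + w) ^ j)) has_sum poly (goss \<beta> j) (inverse (lattice_exp L z))) L)"
    using assms degree_goss_monic[of \<beta> j] by auto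
next
  fix G assume G: "lead_coeff G = 1 \<and> degree G = j \<and> (\<forall>z. z \<notin> L \<longrightarrow>
      ((\<lambda>w. inverse ((z + w) ^ j)) has_sum poly G (inverse (lattice_exp L z))) L)"
  show "G = goss \<beta> j"
  proof (rule poly_eqI_infinite[of "inverse ` lattice_exp L ` (- L)"])
    show "infinite (inverse ` lattice_exp L ` (- L))"
      using assms(3) by (subst finite_image_iff) (auto intro: inj_onI)
    show "poly G x = poly (goss \<beta> j) x" if "x \<in> inverse ` lattice_exp L ` (- L)" for x
      proof -
      from that obtain z where z: "z \<notin> L" "x = inverse (lattice_exp L z)" by auto
      then show ?thesis
        using infsumI[OF assms(4)[OF z(1)]] infsumI[OF G[THEN conjunct2, THEN conjunct2, rule_format, OF z(1)]]
        by simp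
    qed
  qed
qed

end

section \<open>The exponential and the Goss polynomials of the Carlitz lattice\<close>

definition polys_below :: "nat \<Rightarrow> 'q::zero poly set" where
  "polys_below d = {a. \<forall>i\<ge>d. coeff a i = 0}"

text \<open>The zero polynomial is named separately because \<open>degree 0 = 0\<close>: it lies in
  every \<open>polys_below d\<close>, even for \<open>d = 0\<close>.\<close>

lemma polys_below_iff: "a \<in> polys_below d \<longleftrightarrow> a = 0 \<or> degree a < d"
proof
  assume "a \<in> polys_below d"
  then show "a = 0 \<or> degree a < d"
    using leading_coeff_neq_0[of a] by (force simp: polys_below_def not_le)
qed (auto simp: polys_below_def coeff_eq_0)

lemma polys_below_Suc:
  "polys_below (Suc d) = (\<lambda>(c, a). pCons c a) ` (UNIV \<times> polys_below d)"
proof (intro set_eqI iffI)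
  fix a :: "'a poly" assume "a \<in> polys_below (Suc d)"
  then show "a \<in> (\<lambda>(c, a). pCons c a) ` (UNIV \<times> polys_below d)"
    by (cases a) (auto simp: polys_below_def coeff_pCons image_iff split: nat.splits)
next
  fix a :: "'a poly" assume "a \<in> (\<lambda>(c, a). pCons c a) ` (UNIV \<times> polys_below d)"
  then show "a \<in> polys_below (Suc d)"
    by (auto simp: polys_below_def coeff_pCons split: nat.splits)
qed

lemma finite_card_polys_below:
  "finite (polys_below d :: 'q::{finite,zero} poly set) \<and>
   card (polys_below d :: 'q poly set) = CARD('q) ^ d"
proof (induction d)
  case 0
  have "polys_below 0 = {0 :: 'q poly}" by (auto simp: polys_below_iff)
  then show ?case by simp
next
  case (Suc d)
  have "inj_on (\<lambda>(c, a). pCons c a) (UNIV \<times> polys_below d :: ('q \<times> 'q poly) set)"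
    by (auto simp: inj_on_def)
  then show ?case using Suc by (simp add: polys_below_Suc card_image card_cartesian_product)
qed

lemmas finite_polys_below = finite_card_polys_below[THEN conjunct1]
lemmas card_polys_below = finite_card_polys_below[THEN conjunct2]

lemma polys_below_diff:
  "a \<in> polys_below d \<Longrightarrow> b \<in> polys_below d \<Longrightarrow> a - b \<in> polys_below d" for a :: "'q::ab_group_add poly"
  by (simp add: polys_below_def)

text \<open>Division with remainder by \<open>g\<close>. Injectivity comes from reduction modulo
  \<open>g\<close>, surjectivity from counting.\<close>

lemma bij_betw_polys_below:
  fixes g :: "'q::{field,finite} poly"
  assumes "g \<noteq> 0"
  shows "bij_betw (\<lambda>(b, c). b + g * c) (polys_below (degree g) \<times> polys_below k)
    (polys_below (degree g + k))"
  unfolding bij_betw_def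
proof
  let ?f = "\<lambda>(b, c). b + g * c"
  show inj: "inj_on ?f (polys_below (degree g) \<times> polys_below k)"
  proof (rule inj_onI, clarify)
    fix b c b' c'
    assume b: "b \<in> polys_below (degree g)" "b' \<in> polys_below (degree g)"
      and eq: "b + g * c = b' + g * c'"
    have "b mod g = b" "b' mod g = b'"
      using b by (auto simp: polys_below_iff mod_poly_less)
    then have "b = b'"
      using arg_cong[OF eq, of "\<lambda>x. x mod g"] by simp
    then show "b = b' \<and> c = c'" using eq assms by simp
  qed
  have sub: "?f ` (polys_below (degree g) \<times> polys_below k) \<subseteq> polys_below (degree g + k)"
  proof clarify
    fix b c :: "'q poly" assume bc: "b \<in> polys_below (degree g)" "c \<in> polys_below k"
    have "coeff (b + g * c) i = 0" if "degree g + k \<le> i" for i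
    proof -
      have "coeff b i = 0" using bc that by (auto simp: polys_below_def)
      moreover have "coeff (g * c) i = 0"
      proof (cases "c = 0")
        case False
        then have "degree (g * c) < i"
          using bc that assms by (auto simp: polys_below_iff degree_mult_eq)
        then show ?thesis by (rule coeff_eq_0)
      qed simp
      ultimately show ?thesis by simp
    qed
    then show "b + g * c \<in> polys_below (degree g + k)" by (simp add: polys_below_def)
  qed
  show "?f ` (polys_below (degree g) \<times> polys_below k) = polys_below (degree g + k)"
    using sub by (rule card_subset_eq[OF finite_polys_below])
      (simp add: card_image[OF inj] card_cartesian_product card_polys_below power_add)
qed

section \<open>The ring \<open>A\<close> inside the completion, and exponentials of discrete
  sets\<close>

context C_infty
begin

lemma card_gt_1: "1 < CARD('q)"
  using card_mono[of UNIV "{0, 1 :: 'q}"] by simp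

lemma embedding_0: "\<iota> 0 = 0"
  using embedding_add[of 0 0] by (metis add.right_neutral add_left_cancel)

lemma const_emb_0 [simp]: "const_emb \<iota> 0 = 0"
  and const_emb_1 [simp]: "const_emb \<iota> 1 = 1"
  and const_emb_add: "const_emb \<iota> (a + b) = const_emb \<iota> a + const_emb \<iota> b"
  and const_emb_mult: "const_emb \<iota> (a * b) = const_emb \<iota> a * const_emb \<iota> b"
  by (simp_all add: const_emb_def embedding_0 embedding_one
      flip: embedding_add embedding_mult fls_plus_const fls_const_mult_const)

lemma nrm_const_emb: "c \<noteq> 0 \<Longrightarrow> nrm (const_emb \<iota> c) = 1"
  by (simp add: const_emb_def dist_embedding)

lemma nrm_theta: "nrm (theta \<iota>) = real CARD('q)"
  by (simp add: theta_def dist_embedding)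

lemma A_emb_eq_sum:
  "degree a \<le> D \<Longrightarrow> A_emb \<iota> a = (\<Sum>i\<le>D. const_emb \<iota> (coeff a i) * theta \<iota> ^ i)"
  unfolding A_emb_def by (rule sum.mono_neutral_left) (auto simp: coeff_eq_0)

lemma A_emb_0 [simp]: "A_emb \<iota> 0 = 0"
  by (simp add: A_emb_def)

lemma A_emb_pCons: "A_emb \<iota> (pCons c a) = const_emb \<iota> c + theta \<iota> * A_emb \<iota> a"
  by (subst A_emb_eq_sum[of _ "Suc (degree a)"])
     (auto simp: degree_pCons_le sum.atMost_Suc_shift A_emb_def sum_distrib_left mult_ac simp del: sum.atMost_Suc)

lemma A_emb_1: "A_emb \<iota> 1 = 1"
  by (simp add: A_emb_def)

lemma A_emb_add: "A_emb \<iota> (a + b) = A_emb \<iota> a + A_emb \<iota> b"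
  using A_emb_eq_sum[of a "max (degree a) (degree b)"] A_emb_eq_sum[of b "max (degree a) (degree b)"]
    A_emb_eq_sum[of "a + b" "max (degree a) (degree b)"]
  by (simp add: degree_add_le_max const_emb_add algebra_simps sum.distrib)

lemma A_emb_diff: "A_emb \<iota> (a - b) = A_emb \<iota> a - A_emb \<iota> b"
  using A_emb_add[of "a - b" b] by simp

lemma A_emb_smult: "A_emb \<iota> (smult c a) = const_emb \<iota> c * A_emb \<iota> a"
  by (induction a) (simp_all add: A_emb_pCons const_emb_mult algebra_simps)

lemma A_emb_mult: "A_emb \<iota> (a * b) = A_emb \<iota> a * A_emb \<iota> b"
  by (induction a) (simp_all add: A_emb_pCons A_emb_add A_emb_smult algebra_simps)

lemma nrm_A_emb: "a \<noteq> 0 \<Longrightarrow> nrm (A_emb \<iota> a) = real CARD('q) ^ degree a"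
proof (induction a)
  case (pCons c a)
  show ?case
  proof (cases "a = 0")
    case True
    then show ?thesis using pCons by (simp add: A_emb_pCons nrm_const_emb)
  next
    case False
    have "nrm (const_emb \<iota> c) \<le> 1" by (cases "c = 0") (simp_all add: nrm_const_emb)
    also have "1 < nrm (theta \<iota> * A_emb \<iota> a)"
      using False pCons.IH card_gt_1 one_less_power[of "real CARD('q)" "Suc (degree a)"]
      by (simp add: dist_mult nrm_theta)
    finally show ?thesis
      using False pCons.IH by (simp add: A_emb_pCons nrm_add_eq(2) dist_mult nrm_theta)
  qed
qed simp

lemma A_emb_eq_0_iff [simp]: "A_emb \<iota> a = 0 \<longleftrightarrow> a = 0"
  using nrm_A_emb[of a] card_gt_1 by fastforce

lemma A_emb_eq_iff [simp]: "A_emb \<iota> a = A_emb \<iota> b \<longleftrightarrow> a = b"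
  using A_emb_eq_0_iff[of "a - b"] by (simp add: A_emb_diff del: A_emb_eq_0_iff)

lemma infinite_UNIV: "infinite (UNIV :: 'c set)"
proof
  assume fin: "finite (UNIV :: 'c set)"
  have "inj (\<lambda>k. theta \<iota> ^ k)"
  proof (rule injI)
    fix k l assume "theta \<iota> ^ k = theta \<iota> ^ l"
    then have "nrm (theta \<iota> ^ k) = nrm (theta \<iota> ^ l)" by simp
    then show "k = l" using card_gt_1 by (simp add: nrm_power nrm_theta)
  qed
  then show False using fin finite_imageD[of "\<lambda>k. theta \<iota> ^ k" UNIV]
    by (simp add: finite_subset[OF subset_UNIV])
qed

text \<open>A square root of \<open>theta \<iota>\<close> supplies an absolute value that is not an
  integral power of \<open>q\<close>; it is used to find points away from the lattice.\<close>

lemma ex_nrm_sqrt: "\<exists>x. nrm x = sqrt (real CARD('q))"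
proof -
  have alg: "\<iota> f \<in> algebraic_elements \<iota>" for f
    unfolding algebraic_elements_def
    by (auto intro!: exI[of _ "[:- f, 1:]"]
        simp: map_poly_pCons embedding_0 embedding_one simp flip: embedding_add)
  define p where "p = map_poly \<iota> [:- fls_X_inv, 0, 1:]"
  have "coeff p i \<in> algebraic_elements \<iota>" for i
    unfolding p_def by (subst coeff_map_poly) (simp_all add: embedding_0 alg)
  moreover have p: "p = [:\<iota> (- fls_X_inv), 0, 1:]"
    by (simp add: p_def map_poly_pCons embedding_0 embedding_one)
  ultimately obtain x where "poly p x = 0"
    using algebraically_closed[of p] by auto
  moreover have "\<iota> (- fls_X_inv) = - theta \<iota>"
    using embedding_add[of "- fls_X_inv" fls_X_inv]
    by (simp add: theta_def embedding_0 add_eq_0_iff2)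
  ultimately have "x ^ 2 = theta \<iota>"
    by (simp add: p power2_eq_square)
  then have "nrm x ^ 2 = real CARD('q)"
    by (simp flip: nrm_power nrm_theta)
  then show ?thesis
    by (intro exI[of _ x]) (simp add: real_sqrt_unique)
qed

text \<open>Discreteness makes \<open>z / w\<close> tend to 0 along \<open>L\<close>, so the product
  converges and the \<open>Lim\<close> in \<open>lattice_exp\<close> is a genuine limit.\<close>

lemma lattice_exp_tendsto:
  fixes L :: "'c set"
  assumes "\<And>R. finite {w \<in> L. nrm w \<le> R}"
  shows "((\<lambda>S. z * (\<Prod>w\<in>S. 1 - z / w)) \<longlongrightarrow> lattice_exp L z) (finite_subsets_at_top (L - {0}))"
proof -
  have "\<exists>l. ((\<lambda>S. \<Prod>w\<in>S. 1 + - (z / w)) \<longlongrightarrow> l) (finite_subsets_at_top (L - {0}))"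
  proof (rule prod_convergent)
    fix \<epsilon> :: real assume e: "0 < \<epsilon>"
    show "finite {w \<in> L - {0}. \<epsilon> < nrm (- (z / w))}"
    proof (rule finite_subset[OF _ assms[of "nrm z / \<epsilon>"]], safe)
      fix w assume w: "w \<noteq> 0" "\<epsilon> < nrm (- (z / w))"
      have "nrm (- (z / w)) = nrm z / nrm w"
        by (simp add: divide_inverse dist_mult nrm_inverse)
      then have "\<epsilon> * nrm w < nrm z" using w by (simp add: pos_less_divide_eq)
      then show "nrm w \<le> nrm z / \<epsilon>"
        using e by (simp add: pos_le_divide_eq mult.commute)
    qed
  qed
  then obtain l where l: "((\<lambda>S. \<Prod>w\<in>S. 1 - z / w) \<longlongrightarrow> l) (finite_subsets_at_top (L - {0}))"
    by auto
  then have "lattice_exp L z = z * l"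
    unfolding lattice_exp_def using tendsto_Lim[OF finite_subsets_at_top_neq_bot l] by simp
  then show ?thesis using lim_mult[OF tendsto_const l, of z] by simp
qed

lemma poly_exp_poly: "poly (exp_poly L) z = z * (\<Prod>w\<in>L - {0}. 1 - z / w)"
  by (simp add: exp_poly_def poly_prod divide_inverse)

lemma lattice_exp_finite:
  assumes "finite L"
  shows "lattice_exp L z = poly (exp_poly L) z"
proof -
  have l: "((\<lambda>S. \<Prod>w\<in>S. 1 - z / w) \<longlongrightarrow> (\<Prod>w\<in>L - {0}. 1 - z / w)) (finite_subsets_at_top (L - {0}))"
    using assms by (simp add: finite_subsets_at_top_finite tendsto_principal_singleton)
  show ?thesis
    unfolding lattice_exp_def poly_exp_poly tendsto_Lim[OF finite_subsets_at_top_neq_bot l] ..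
qed

lemma goss_poly_finite:
  assumes "finite_subgroup (L :: 'c set)" "0 < j"
  shows "goss_poly j L = goss (coeff (exp_poly L)) j"
proof (rule goss_poly_eqI)
  interpret finite_subgroup L by fact
  show "coeff (exp_poly L) 1 = 1" by (rule coeff_exp_poly_1)
  show "infinite (lattice_exp L ` (- L))"
  proof
    assume "finite (lattice_exp L ` (- L))"
    moreover have "infinite (- L)"
      using infinite_UNIV finite_L by (simp add: Compl_eq_Diff_UNIV)
    \<comment> \<open>By the pigeonhole principle some value is taken infinitely often, which would
      force the polynomial \<open>exp_poly L\<close> to be constant.\<close>
    ultimately obtain y where "infinite {x. lattice_exp L x = lattice_exp L y}"
      using inf_img_fin_dom[of "lattice_exp L" "- L"] by (auto simp: vimage_def)
    then have "infinite {x. poly (exp_poly L - [:lattice_exp L y:]) x = 0}"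
      by (simp add: lattice_exp_finite finite_L)
    then have "exp_poly L = [:lattice_exp L y:]"
      using poly_roots_finite[of "exp_poly L - [:lattice_exp L y:]"] by auto
    then show False using degree_exp_poly card_pos by simp
  qed
  fix z assume z: "z \<notin> L"
  have "poly (goss (coeff (exp_poly L)) j) (inverse (poly (exp_poly L) z)) =
      (\<Sum>l\<in>L. inverse ((z + l) ^ j))"
    using power_sum_recursion[OF infinite_UNIV z] assms(2)
    by (rule poly_goss_eqI[where s = "\<lambda>j. \<Sum>l\<in>L. inverse ((z + l) ^ j)"])
  then show "((\<lambda>w. inverse ((z + w) ^ j)) has_sum
      poly (goss (coeff (exp_poly L)) j) (inverse (lattice_exp L z))) L"
    using finite_L by (simp add: lattice_exp_finite)
qed (rule assms(2))

end

section \<open>The Carlitz exponential as a limit over finite subgroups of its lattice\<close>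

locale carlitz_uniformization = C_infty \<iota>
  for \<iota> :: "'q::{field,finite} fls \<Rightarrow> 'c::{field,complete_space}" +
  fixes \<pi> :: 'c
  assumes period: "carlitz_period \<iota> \<pi>"
begin

abbreviation \<Lambda> :: "'c set" where "\<Lambda> \<equiv> carlitz_lattice \<iota> \<pi>"
abbreviation e :: "'c \<Rightarrow> 'c" where "e \<equiv> lattice_exp \<Lambda>"

definition lat :: "nat \<Rightarrow> 'c set" where
  "lat d = (\<lambda>a. A_emb \<iota> a * \<pi>) ` polys_below d"

lemma period_nonzero [simp]: "\<pi> \<noteq> 0"
  using period by (simp add: carlitz_period_def)

lemma e_A_emb_mult: "e (A_emb \<iota> a * z) = carlitz \<iota> a (e z)"
  using period by (simp add: carlitz_period_def)

lemma lattice_memI [intro]: "A_emb \<iota> a * \<pi> \<in> \<Lambda>"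
  by (simp add: carlitz_lattice_def)

lemma lat_subset: "lat d \<subseteq> \<Lambda>"
  by (auto simp: lat_def)

lemma inj_lat: "inj_on (\<lambda>a. A_emb \<iota> a * \<pi>) X"
  by (auto simp: inj_on_def)

lemma finite_subgroup_lat: "finite_subgroup (lat d)"
proof
  show "finite (lat d)" by (simp add: lat_def finite_polys_below)
  show "0 \<in> lat d" by (auto simp: lat_def polys_below_iff image_iff intro!: bexI[of _ 0])
  show "x - y \<in> lat d" if "x \<in> lat d" "y \<in> lat d" for x y
    using that by (auto simp: lat_def polys_below_diff simp flip: left_diff_distrib A_emb_diff)
qed

text \<open>The groups \<open>lat d\<close> are cofinal among the finite subsets of the lattice, so
  limits over finite subsets may be taken along \<open>d\<close> and inherit the results on finite
  subgroups.\<close>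

lemma filterlim_lat: "filterlim lat (finite_subsets_at_top \<Lambda>) sequentially"
  unfolding filterlim_finite_subsets_at_top
proof (intro allI impI)
  fix X assume X: "finite X \<and> X \<subseteq> \<Lambda>"
  have "\<forall>x\<in>X. \<forall>\<^sub>F d in sequentially. x \<in> lat d"
  proof
    fix x assume "x \<in> X"
    then obtain a where a: "x = A_emb \<iota> a * \<pi>" using X by (auto simp: carlitz_lattice_def)
    show "\<forall>\<^sub>F d in sequentially. x \<in> lat d"
      by (rule eventually_sequentiallyI[of "Suc (degree a)"]) (auto simp: a lat_def polys_below_iff)
  qed
  then have "\<forall>\<^sub>F d in sequentially. \<forall>x\<in>X. x \<in> lat d"
    using X by (subst eventually_ball_finite_distrib) auto
  then show "\<forall>\<^sub>F d in sequentially. finite (lat d) \<and> X \<subseteq> lat d \<and> lat d \<subseteq> \<Lambda>"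
    by eventually_elim (use lat_subset finite_subgroup.finite_L[OF finite_subgroup_lat] in auto)
qed

lemma filterlim_lat_nonzero:
  "filterlim (\<lambda>d. lat d - {0}) (finite_subsets_at_top (\<Lambda> - {0})) sequentially"
  unfolding filterlim_finite_subsets_at_top
proof (intro allI impI)
  fix X assume X: "finite X \<and> X \<subseteq> \<Lambda> - {0}"
  then have "\<forall>\<^sub>F d in sequentially. finite (lat d) \<and> X \<subseteq> lat d \<and> lat d \<subseteq> \<Lambda>"
    using filterlim_lat unfolding filterlim_finite_subsets_at_top by auto
  then show "\<forall>\<^sub>F d in sequentially. finite (lat d - {0}) \<and> X \<subseteq> lat d - {0} \<and> lat d - {0} \<subseteq> \<Lambda> - {0}"
    by eventually_elim (use X in auto)
qed

lemma finite_lattice_ball: "finite {w \<in> \<Lambda>. nrm w \<le> R}"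
proof -
  obtain D where D: "R / nrm \<pi> < real CARD('q) ^ D"
    using real_arch_pow[of "real CARD('q)"] card_gt_1 by auto
  have "{w \<in> \<Lambda>. nrm w \<le> R} \<subseteq> lat D"
  proof safe
    fix w assume w: "w \<in> \<Lambda>" "nrm w \<le> R"
    then obtain a where a: "w = A_emb \<iota> a * \<pi>" by (auto simp: carlitz_lattice_def)
    have "degree a < D" if "a \<noteq> 0"
    proof -
      have "real CARD('q) ^ degree a \<le> R / nrm \<pi>"
        using w(2) that by (simp add: a dist_mult nrm_A_emb pos_le_divide_eq)
      then have "real CARD('q) ^ degree a < real CARD('q) ^ D" using D by simp
      then show ?thesis using card_gt_1 by simp
    qed
    then have "a \<in> polys_below D" by (auto simp: polys_below_iff)
    then show "w \<in> lat D" by (simp add: a lat_def)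
  qed
  then show ?thesis
    using finite_subgroup.finite_L[OF finite_subgroup_lat] finite_subset by blast
qed

lemma tendsto_e: "(\<lambda>d. poly (exp_poly (lat d)) z) \<longlonglongrightarrow> e z"
  unfolding poly_exp_poly
  by (rule filterlim_compose[OF lattice_exp_tendsto[OF finite_lattice_ball] filterlim_lat_nonzero])

lemma e_add: "e (x + y) = e x + e y"
proof (rule LIMSEQ_unique[OF tendsto_e])
  show "(\<lambda>d. poly (exp_poly (lat d)) (x + y)) \<longlonglongrightarrow> e x + e y"
    unfolding finite_subgroup.poly_exp_poly_add[OF finite_subgroup_lat]
    by (intro lim_add tendsto_e)
qed

lemma e_0 [simp]: "e 0 = 0"
  using e_add[of 0 0] by (metis add.right_neutral add_left_cancel)

lemma e_diff: "e (x - y) = e x - e y"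
  using e_add[of "x - y" y] by simp

lemma e_lattice: "w \<in> \<Lambda> \<Longrightarrow> e w = 0"
proof -
  assume "w \<in> \<Lambda>"
  then obtain a where a: "w = A_emb \<iota> a * \<pi>" by (auto simp: carlitz_lattice_def)
  have "poly (exp_poly (lat d)) w = 0" if "Suc (degree a) \<le> d" for d
  proof -
    have "w \<in> lat d" using that by (auto simp: a lat_def polys_below_iff)
    then show ?thesis
      by (simp add: finite_subgroup.exp_poly_eq_0_iff[OF finite_subgroup_lat])
  qed
  then have "\<forall>\<^sub>F d in sequentially. poly (exp_poly (lat d)) w = 0"
    by (rule eventually_sequentiallyI)
  then have "(\<lambda>d. poly (exp_poly (lat d)) w) \<longlonglongrightarrow> 0" by (rule tendsto_eventually)
  then show ?thesis using tendsto_e LIMSEQ_unique by blast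
qed

definition power_sum :: "nat \<Rightarrow> 'c \<Rightarrow> 'c" where
  "power_sum j z = infsum (\<lambda>w. inverse ((z + w) ^ j)) \<Lambda>"

lemma has_sum_power_sum:
  assumes "0 < j"
  shows "((\<lambda>w. inverse ((z + w) ^ j)) has_sum power_sum j z) \<Lambda>"
proof -
  have "\<exists>s. ((\<lambda>w. inverse ((z + w) ^ j)) has_sum s) \<Lambda>"
  proof (rule has_sum_exists)
    fix \<epsilon> :: real assume eps: "0 < \<epsilon>"
    \<comment> \<open>For \<open>nrm w > R\<close> one has \<open>nrm (z + w) = nrm w > 1\<close>,
      hence \<open>nrm (z + w) ^ j \<ge> nrm w > 1 / \<epsilon>\<close>.\<close>
    define R where "R = max (nrm z) (max 1 (1 / \<epsilon>))"
    show "finite {w \<in> \<Lambda>. \<epsilon> < nrm (inverse ((z + w) ^ j))}"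
    proof (rule finite_subset[OF _ finite_lattice_ball[of R]], safe, rule ccontr)
      fix w assume w: "\<epsilon> < nrm (inverse ((z + w) ^ j))" "\<not> nrm w \<le> R"
      then have "nrm z < nrm w" "1 < nrm w" "1 / \<epsilon> < nrm w" by (auto simp: R_def)
      then have "1 / \<epsilon> < nrm (z + w) ^ j"
        using self_le_power[of "nrm w" j] assms by (simp add: nrm_add_eq(2))
      moreover have "\<epsilon> < inverse (nrm (z + w) ^ j)"
        using w(1) by (simp add: nrm_inverse nrm_power)
      moreover have "0 < nrm (z + w) ^ j"
        using calculation(1) eps by (auto intro: less_trans[of 0 "1 / \<epsilon>"])
      ultimately show False using eps by (simp add: field_simps)
    qed
  qed
  then show ?thesis
    unfolding power_sum_def by (metis infsumI)
qed

lemma tendsto_power_sum: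
  assumes "0 < j"
  shows "(\<lambda>d. \<Sum>w\<in>lat d. inverse ((z + w) ^ j)) \<longlonglongrightarrow> power_sum j z"
  using filterlim_compose[OF has_sum_power_sum[OF assms, unfolded has_sum_def] filterlim_lat] .

text \<open>The recursion is stated with the reciprocal of the exponential cleared, so that letting
  \<open>d\<close> tend to infinity involves only sums and products.\<close>

lemma lat_power_sum_recursion:
  assumes "z \<notin> \<Lambda>"
  shows "poly (exp_poly (lat d)) z * (\<Sum>w\<in>lat d. inverse ((z + w) ^ Suc j)) =
    (if j = 0 then 1 else 0) +
    (\<Sum>m=1..j. coeff (exp_poly (lat d)) m * (\<Sum>w\<in>lat d. inverse ((z + w) ^ (Suc j - m))))"
proof -
  interpret finite_subgroup "lat d" by (rule finite_subgroup_lat)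
  have z: "z \<notin> lat d" using assms lat_subset by auto
  then have "poly (exp_poly (lat d)) z \<noteq> 0" by (simp add: exp_poly_eq_0_iff)
  then show ?thesis
    unfolding power_sum_recursion[OF infinite_UNIV z] by (simp only: mult.assoc[symmetric]) simp
qed

text \<open>The limit of the recursion at \<open>j = 0\<close>. It shows that \<open>e\<close> has
  no zeros outside the lattice.\<close>

lemma e_times_power_sum_1:
  assumes "z \<notin> \<Lambda>"
  shows "e z * power_sum 1 z = 1"
proof (rule LIMSEQ_unique)
  show "(\<lambda>d. poly (exp_poly (lat d)) z * (\<Sum>w\<in>lat d. inverse ((z + w) ^ 1))) \<longlonglongrightarrow> e z * power_sum 1 z"
    by (intro lim_mult tendsto_e tendsto_power_sum) simp
  show "(\<lambda>d. poly (exp_poly (lat d)) z * (\<Sum>w\<in>lat d. inverse ((z + w) ^ 1))) \<longlonglongrightarrow> 1"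
    using lat_power_sum_recursion[OF assms, of _ 0] by simp
qed

lemma e_eq_0_iff: "e z = 0 \<longleftrightarrow> z \<in> \<Lambda>"
  using e_lattice e_times_power_sum_1[of z] by force

text \<open>The absolute values of the points of \<open>\<Lambda>\<close> are \<open>\<bar>\<pi>\<bar> q ^ i\<close>, so points whose absolute value is
  a half-integral power of \<open>q\<close> times \<open>\<bar>\<pi>\<bar>\<close> keep away from \<open>\<Lambda>\<close>.\<close>

lemma far_point:
  assumes z: "nrm z = nrm \<pi> * sqrt (real CARD('q)) * real CARD('q) ^ k"
  shows "z \<notin> \<Lambda>" "nrm z \<le> nrm (e z)"
proof -
  let ?q = "real CARD('q)"
  have neq: "nrm w \<noteq> nrm z" if w: "w \<in> \<Lambda>" for w
  proof
    assume eq: "nrm w = nrm z"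
    obtain a where a: "w = A_emb \<iota> a * \<pi>" using w by (auto simp: carlitz_lattice_def)
    have "0 < nrm z" using z card_gt_1 by simp
    then have "a \<noteq> 0" using eq a by auto
    then have "?q ^ degree a = sqrt ?q * ?q ^ k"
      using eq z by (simp add: a dist_mult nrm_A_emb)
    \<comment> \<open>Squaring turns the equality of absolute values into one between an even and an
      odd power of \<open>q\<close>.\<close>
    then have "(?q ^ degree a)\<^sup>2 = (sqrt ?q)\<^sup>2 * (?q ^ k)\<^sup>2"
      by (simp add: power_mult_distrib)
    then have "?q ^ (2 * degree a) = ?q ^ (2 * k + 1)"
      by (simp add: power_mult [symmetric] mult.commute)
    moreover have "1 < ?q" using card_gt_1 by simp
    ultimately have "2 * degree a = 2 * k + 1"
      using power_inject_exp by blast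
    then show False by presburger
  qed
  then show z': "z \<notin> \<Lambda>" by auto
  have z0: "0 < nrm z" using z card_gt_1 by simp
  \<comment> \<open>Unequal absolute values give \<open>nrm (z + w) \<ge> nrm z\<close>, so the sum
    of the \<open>1/(z + w)\<close> is at most \<open>1 / nrm z\<close> in absolute value; its
    product with the exponential is 1.\<close>
  have "nrm z \<le> nrm (poly (exp_poly (lat d)) z)" for d
  proof -
    have "nrm (\<Sum>w\<in>lat d. inverse ((z + w) ^ 1)) \<le> inverse (nrm z)"
    proof (rule nrm_sum_le)
      fix w assume "w \<in> lat d"
      then have "nrm w \<noteq> nrm z" using neq lat_subset by blast
      then have "nrm z \<le> nrm (z + w)"
        using nrm_add_eq[of w z] nrm_add_eq[of z w] by (cases "nrm w < nrm z") auto
      then show "nrm (inverse ((z + w) ^ 1)) \<le> inverse (nrm z)"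
        using z0 by (simp add: nrm_inverse le_imp_inverse_le)
    qed simp
    then have "nrm (poly (exp_poly (lat d)) z) * nrm (\<Sum>w\<in>lat d. inverse ((z + w) ^ 1)) \<le>
        nrm (poly (exp_poly (lat d)) z) * inverse (nrm z)"
      by (rule mult_left_mono) simp
    moreover have "nrm (poly (exp_poly (lat d)) z) * nrm (\<Sum>w\<in>lat d. inverse ((z + w) ^ 1)) = 1"
      using lat_power_sum_recursion[OF z', of d 0] by (simp flip: dist_mult)
    ultimately show ?thesis using z0 by (simp add: field_simps)
  qed
  moreover have "(\<lambda>d. nrm (poly (exp_poly (lat d)) z)) \<longlonglongrightarrow> nrm (e z)"
    by (intro tendsto_dist tendsto_const tendsto_e)
  ultimately show "nrm z \<le> nrm (e z)"
    by (intro tendsto_lowerbound) auto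
qed

lemma ex_far_point:
  "\<exists>z. nrm z = nrm \<pi> * sqrt (real CARD('q)) * real CARD('q) ^ k"
proof -
  obtain x where "nrm x = sqrt (real CARD('q))" using ex_nrm_sqrt by blast
  then show ?thesis
    by (intro exI[of _ "\<pi> * x * theta \<iota> ^ k"]) (simp add: dist_mult nrm_power nrm_theta)
qed

lemma ex_far_point_gt:
  obtains k z where "nrm z = nrm \<pi> * sqrt (real CARD('q)) * real CARD('q) ^ k" "R < nrm (e z)"
proof -
  let ?c = "nrm \<pi> * sqrt (real CARD('q))"
  have c: "0 < ?c" using card_gt_1 by simp
  obtain k where "R / ?c < real CARD('q) ^ k"
    using real_arch_pow[of "real CARD('q)"] card_gt_1 by auto
  then have "R < ?c * real CARD('q) ^ k" using c by (simp add: field_simps)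
  moreover obtain z where z: "nrm z = ?c * real CARD('q) ^ k" using ex_far_point by blast
  ultimately have "R < nrm (e z)" using far_point(2)[OF z] by linarith
  then show thesis using that z by blast
qed

text \<open>A finite image would be bounded, while \<open>e\<close> is unbounded on the far points.
  Multiplication by \<open>a\<close> only raises the exponent \<open>k\<close> of a far point by
  \<open>degree a\<close>, so these points lie in the set.\<close>

lemma infinite_e_image:
  assumes "a \<noteq> 0"
  shows "infinite (e ` {z. A_emb \<iota> a * z \<notin> \<Lambda>})"
proof
  let ?Y = "e ` {z. A_emb \<iota> a * z \<notin> \<Lambda>}"
  assume fin: "finite ?Y"
  obtain k z where z: "nrm z = nrm \<pi> * sqrt (real CARD('q)) * real CARD('q) ^ k"
    and gt: "Max (nrm ` ?Y) < nrm (e z)"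
    by (rule ex_far_point_gt)
  have "nrm (A_emb \<iota> a * z) = nrm \<pi> * sqrt (real CARD('q)) * real CARD('q) ^ (k + degree a)"
    using assms by (simp add: dist_mult nrm_A_emb z power_add)
  then have "A_emb \<iota> a * z \<notin> \<Lambda>" by (rule far_point)
  then have "nrm (e z) \<le> Max (nrm ` ?Y)" using fin by (intro Max_ge) auto
  then show False using gt by simp
qed

text \<open>These limits take the place of the power series coefficients of \<open>e\<close>, which
  itself is never expanded.\<close>

definition carlitz_coeff :: "nat \<Rightarrow> 'c" where
  "carlitz_coeff m = lim (\<lambda>d. coeff (exp_poly (lat d)) m)"

text \<open>The recursion for the power sums at a single point determines the coefficients of the
  \<open>exp_poly (lat d)\<close> from the power sums, so they converge because the power sums do.\<close>

lemma tendsto_carlitz_coeff: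
  assumes "0 < m"
  shows "(\<lambda>d. coeff (exp_poly (lat d)) m) \<longlonglongrightarrow> carlitz_coeff m"
  using assms
proof (induction m rule: less_induct)
  case (less m)
  obtain z where z: "z \<notin> \<Lambda>" using far_point(1) ex_far_point[of 0] by blast
  define s where "s = (\<lambda>d j. \<Sum>w\<in>lat d. inverse ((z + w) ^ j))"
  define E where "E = (\<lambda>d. poly (exp_poly (lat d)) z)"
  define c where "c = (\<lambda>d i. coeff (exp_poly (lat d)) i)"
  obtain n where n: "m = Suc n" using less.prems by (cases m) auto
  \<comment> \<open>The recursion with \<open>j = m\<close> is solved for its last term
    \<open>c d m * s d 1\<close>, using \<open>E d * s d 1 = 1\<close>.\<close>
  have c_eq: "c d m = E d * (E d * s d (Suc m) - (\<Sum>i=1..n. c d i * s d (Suc m - i)))" for d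
  proof -
    have "E d * s d (Suc m) = (\<Sum>i=1..n. c d i * s d (Suc m - i)) + c d m * s d 1"
      using lat_power_sum_recursion[OF z, of d m] by (simp add: s_def E_def c_def n)
    moreover have "E d * s d 1 = 1"
      using lat_power_sum_recursion[OF z, of d 0] by (simp add: s_def E_def)
    ultimately show ?thesis by (simp add: algebra_simps)
  qed
  have "(\<lambda>d. c d m) \<longlonglongrightarrow>
      e z * (e z * power_sum (Suc m) z - (\<Sum>i=1..n. carlitz_coeff i * power_sum (Suc m - i) z))"
    unfolding c_eq unfolding s_def E_def c_def
    by (intro lim_mult lim_diff lim_sum tendsto_e tendsto_power_sum less.IH) (auto simp: n)
  then have "convergent (\<lambda>d. coeff (exp_poly (lat d)) m)"
    unfolding c_def by (rule convergentI)
  then show ?case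
    unfolding carlitz_coeff_def by (rule convergent_LIMSEQ_iff[THEN iffD1])
qed

lemma carlitz_coeff_1: "carlitz_coeff 1 = 1"
  using tendsto_carlitz_coeff[of 1] finite_subgroup.coeff_exp_poly_1[OF finite_subgroup_lat]
  by (simp add: LIMSEQ_const_iff)

lemma power_sum_eq_poly_goss:
  assumes z: "z \<notin> \<Lambda>" and "0 < j"
  shows "power_sum j z = poly (goss carlitz_coeff j) (inverse (e z))"
proof (rule poly_goss_eqI[symmetric, where s = "\<lambda>j. power_sum j z"])
  fix j
  have "e z * power_sum (Suc j) z =
      (if j = 0 then 1 else 0) + (\<Sum>m=1..j. carlitz_coeff m * power_sum (Suc j - m) z)"
  proof (rule LIMSEQ_unique)
    show "(\<lambda>d. poly (exp_poly (lat d)) z * (\<Sum>w\<in>lat d. inverse ((z + w) ^ Suc j)))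
        \<longlonglongrightarrow> e z * power_sum (Suc j) z"
      by (intro lim_mult tendsto_e tendsto_power_sum) simp
    show "(\<lambda>d. poly (exp_poly (lat d)) z * (\<Sum>w\<in>lat d. inverse ((z + w) ^ Suc j)))
        \<longlonglongrightarrow> (if j = 0 then 1 else 0) + (\<Sum>m=1..j. carlitz_coeff m * power_sum (Suc j - m) z)"
      unfolding lat_power_sum_recursion[OF z]
      by (intro lim_add lim_sum lim_mult tendsto_const tendsto_carlitz_coeff tendsto_power_sum) auto
  qed
  moreover have "e z \<noteq> 0" using z by (simp add: e_eq_0_iff)
  then have "power_sum (Suc j) z = inverse (e z) * (e z * power_sum (Suc j) z)"
    by (simp flip: mult.assoc)
  ultimately show "power_sum (Suc j) z = inverse (e z) *
      ((if j = 0 then 1 else 0) + (\<Sum>m=1..j. carlitz_coeff m * power_sum (Suc j - m) z))"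
    by (simp only:)
qed (rule assms(2))

lemma goss_poly_lattice:
  assumes "0 < j"
  shows "goss_poly j \<Lambda> = goss carlitz_coeff j"
proof (rule goss_poly_eqI)
  show "carlitz_coeff 1 = 1" by (rule carlitz_coeff_1)
  show "infinite (e ` (- \<Lambda>))"
    using infinite_e_image[of 1] by (simp add: A_emb_1 Compl_eq)
  show "((\<lambda>w. inverse ((z + w) ^ j)) has_sum poly (goss carlitz_coeff j) (inverse (e z))) \<Lambda>"
    if "z \<notin> \<Lambda>" for z
    using has_sum_power_sum[OF assms, of z] power_sum_eq_poly_goss[OF that assms] by simp
qed (rule assms)

end

section \<open>Division points and the trace\<close>

lemma poly_fps_eq_compose:
  fixes p :: "'a::field poly"
  assumes "fps_nth F 0 = 0"
  shows "poly_fps p F = fps_of_poly p oo F"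
proof -
  have "fps_of_poly p = (\<Sum>i\<le>degree p. fps_const (coeff p i) * fps_X ^ i)"
    by (subst (1) poly_as_sum_of_monoms[of p, symmetric]) (simp add: fps_of_poly_sum fps_of_poly_monom)
  then show ?thesis
    using assms by (simp add: poly_fps_eq_sum_atMost[OF order_refl] fps_compose_sum_distrib
        fps_compose_mult_distrib flip: fps_compose_power)
qed

lemma poly_fps_compose:
  fixes p :: "'a::field poly"
  assumes "fps_nth V 0 = 0"
  shows "poly_fps p F oo V = poly_fps p (F oo V)"
  using assms by (simp add: poly_fps_eq_sum_atMost[OF order_refl] fps_compose_sum_distrib
      fps_compose_mult_distrib fps_compose_power)

lemma poly_fps_smult:
  fixes p :: "'a::field poly"
  shows "poly_fps (smult c p) F = fps_const c * poly_fps p F"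
  by (subst (1 2) poly_fps_eq_sum_atMost[of _ "degree p"])
     (simp_all add: degree_smult_le sum_distrib_left mult.assoc flip: fps_const_mult)

lemma poly_fps_nth_eq_0:
  fixes p :: "'a::field poly"
  assumes "coeff p 0 = 0" "\<And>i. i < N \<Longrightarrow> fps_nth F i = 0" "i < N"
  shows "fps_nth (poly_fps p F) i = 0"
proof -
  obtain p' where "p = pCons 0 p'" using assms(1) by (cases p) auto
  then have "poly_fps p F = F * poly_fps p' F"
    by (simp add: poly_fps_def map_poly_pCons)
  then show ?thesis
    using assms(2,3) by (auto simp: fps_mult_nth intro!: sum.neutral)
qed

text \<open>Allows an identity for \<open>T_hat\<close> to be checked after substituting the
  expansion of \<open>u_g\<close>, where \<open>T_hat\<close> becomes a trace.\<close>

lemma fps_compose_inj: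
  fixes F G V :: "'a::field fps"
  assumes "fps_nth V 0 = 0" "V \<noteq> 0" "F oo V = G oo V"
  shows "F = G"
proof -
  have "(F - G) oo V = 0" using assms(3) by (simp add: fps_compose_sub_distrib)
  then show ?thesis using fps_compose_eq_0_iff[OF assms(1), of "F - G"] assms(2) by auto
qed

section \<open>The Carlitz module as a family of polynomials\<close>

context C_infty
begin

definition theta_step :: "'c poly \<Rightarrow> 'c poly" where
  "theta_step p = smult (theta \<iota>) p + p ^ CARD('q)"

text \<open>The polynomial \<open>C_a\<close> for \<open>a\<close> the \<open>i\<close>-th power of
  the variable of \<open>A\<close>.\<close>

definition theta_poly :: "nat \<Rightarrow> 'c poly" where
  "theta_poly i = (theta_step ^^ i) [:0, 1:]"

definition carlitz_poly :: "'q poly \<Rightarrow> 'c poly" where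
  "carlitz_poly a = (\<Sum>i\<le>degree a. smult (const_emb \<iota> (coeff a i)) (theta_poly i))"

lemma theta_poly_Suc: "theta_poly (Suc i) = theta_step (theta_poly i)"
  by (simp add: theta_poly_def)

lemma poly_theta_poly: "poly (theta_poly i) x = (carlitz_theta \<iota> ^^ i) x"
proof (induction i)
  case (Suc i)
  then show ?case by (simp add: theta_poly_Suc theta_step_def carlitz_theta_def)
qed (simp add: theta_poly_def)

text \<open>The polynomial is divisible by \<open>X\<close>, so its \<open>q\<close>-th power is
  divisible by \<open>X ^ q\<close> with \<open>q > 1\<close> and does not affect the linear
  coefficient.\<close>

lemma coeff_theta_poly: "coeff (theta_poly i) 0 = 0 \<and> coeff (theta_poly i) 1 = theta \<iota> ^ i"
proof (induction i)
  case (Suc i)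
  then obtain p where "theta_poly i = pCons 0 p" by (cases "theta_poly i") auto
  then have "theta_poly i = monom 1 1 * p" by (simp add: monom_altdef)
  then have "theta_poly i ^ CARD('q) = monom 1 CARD('q) * p ^ CARD('q)"
    by (simp add: power_mult_distrib monom_power)
  then show ?case
    using Suc card_gt_1 by (simp add: theta_poly_Suc theta_step_def coeff_monom_mult)
qed (simp add: theta_poly_def)

lemma degree_theta_poly: "degree (theta_poly i) = CARD('q) ^ i \<and> lead_coeff (theta_poly i) = 1"
proof (induction i)
  case (Suc i)
  then have "theta_poly i \<noteq> 0" by auto
  then have deg: "degree (theta_poly i ^ CARD('q)) = CARD('q) ^ Suc i"
    using Suc by (simp add: degree_power_eq)
  moreover have "degree (smult (theta \<iota>) (theta_poly i)) < CARD('q) ^ Suc i"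
    using Suc card_gt_1 by (intro le_less_trans[OF degree_smult_le]) simp
  moreover have "lead_coeff (theta_poly i ^ CARD('q)) = 1"
    using Suc.IH by (metis lead_coeff_power power_one)
  ultimately show ?case
    unfolding theta_poly_Suc theta_step_def
    by (metis degree_add_eq_right lead_coeff_add_le)
qed (simp add: theta_poly_def)

lemma poly_carlitz_poly: "poly (carlitz_poly a) x = carlitz \<iota> a x"
  by (simp add: carlitz_poly_def carlitz_def poly_sum poly_theta_poly)

lemma coeff_carlitz_poly_1: "coeff (carlitz_poly a) 1 = A_emb \<iota> a"
  using coeff_theta_poly by (simp add: carlitz_poly_def A_emb_def coeff_sum)

lemma degree_carlitz_poly:
  assumes "lead_coeff a = 1"
  shows "degree (carlitz_poly a) = CARD('q) ^ degree a" "lead_coeff (carlitz_poly a) = 1"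
proof -
  define r where "r = (\<Sum>i<degree a. smult (const_emb \<iota> (coeff a i)) (theta_poly i))"
  have eq: "carlitz_poly a = r + theta_poly (degree a)"
    using assms by (simp add: carlitz_poly_def r_def lessThan_Suc_atMost[symmetric])
  have r: "degree r < degree (theta_poly (degree a))"
    unfolding r_def
  proof (rule degree_sum_less)
    fix i assume "i \<in> {..<degree a}"
    then have "degree (theta_poly i) < degree (theta_poly (degree a))"
      using degree_theta_poly card_gt_1 by simp
    then show "degree (smult (const_emb \<iota> (coeff a i)) (theta_poly i)) < degree (theta_poly (degree a))"
      by (rule le_less_trans[OF degree_smult_le])
  qed (use degree_theta_poly card_gt_1 in simp)
  show "degree (carlitz_poly a) = CARD('q) ^ degree a"
    unfolding eq using degree_theta_poly r by (simp add: degree_add_eq_right)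
  show "lead_coeff (carlitz_poly a) = 1"
    unfolding eq lead_coeff_add_le[OF r] using degree_theta_poly by blast
qed

end

section \<open>Expansions of \<open>u_a\<close> and identities checked on values of
  \<open>e\<close>\<close>

context carlitz_uniformization
begin

text \<open>This is \<open>e(a z) = C_a(e(z))\<close> written in \<open>u\<close>. It holds at the
  poles too, since \<open>inverse\<close> with \<open>inverse 0 = 0\<close> is an
  involution.\<close>

lemma u_param_A_emb_mult:
  "u_param \<iota> \<pi> (A_emb \<iota> a * z) = inverse (poly (carlitz_poly a) (inverse (u_param \<iota> \<pi> z)))"
  using e_A_emb_mult[of a "\<pi> * z"] by (simp add: u_param_def poly_carlitz_poly mult_ac)

lemma period_mult_mem_iff: "\<pi> * z \<in> \<Lambda> \<longleftrightarrow> z \<in> range (A_emb \<iota>)"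
  by (auto simp: carlitz_lattice_def mult.commute[of \<pi>])

lemma u_param_neq_0: "z \<notin> range (A_emb \<iota>) \<Longrightarrow> u_param \<iota> \<pi> z \<noteq> 0"
  by (simp add: u_param_def e_eq_0_iff period_mult_mem_iff)

lemma ex_small_u_param:
  assumes "0 < \<epsilon>"
  shows "\<exists>z. z \<notin> range (A_emb \<iota>) \<and> nrm (u_param \<iota> \<pi> z) < \<epsilon>"
proof -
  obtain k z where z: "nrm z = nrm \<pi> * sqrt (real CARD('q)) * real CARD('q) ^ k" "1 / \<epsilon> < nrm (e z)"
    by (rule ex_far_point_gt)
  have "0 < nrm (e z)" using z(2) assms by (auto intro: less_trans[of 0 "1 / \<epsilon>"])
  moreover have "nrm (u_param \<iota> \<pi> (z / \<pi>)) = inverse (nrm (e z))"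
    by (simp add: u_param_def nrm_inverse)
  moreover have "inverse (nrm (e z)) < \<epsilon>" if "0 < nrm (e z)"
    using that z(2) assms by (simp add: field_simps)
  ultimately have "nrm (u_param \<iota> \<pi> (z / \<pi>)) < \<epsilon>"
    by simp
  moreover have "z / \<pi> \<notin> range (A_emb \<iota>)"
    using far_point(1)[OF z(1)] period_mult_mem_iff[of "z / \<pi>"] by simp
  ultimately show ?thesis by blast
qed

text \<open>Resolves the \<open>THE\<close> in \<open>u_expansion\<close>. Existence evaluates the
  reciprocal series at \<open>u(z)\<close>; for uniqueness, the difference of two expansions
  vanishes at nonzero values \<open>u(z)\<close> arbitrarily close to 0.\<close>

lemma u_sub_eq:
  assumes "lead_coeff a = 1"
  shows "u_sub \<iota> \<pi> a = recip_fps (carlitz_poly a)"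
  unfolding u_sub_def u_expansion_def
proof (rule the_equality)
  obtain r where "0 < r" and r: "\<And>t. t \<noteq> 0 \<Longrightarrow> nrm t < r \<Longrightarrow>
      (\<lambda>n. fps_nth (recip_fps (carlitz_poly a)) n * t ^ n) sums inverse (poly (carlitz_poly a) (inverse t))"
    using recip_fps_sums[OF degree_carlitz_poly(2)[OF assms]] by blast
  then show 1: "\<exists>r>0. \<forall>z. z \<notin> range (A_emb \<iota>) \<and> nrm (u_param \<iota> \<pi> z) < r \<longrightarrow>
      (\<lambda>n. fps_nth (recip_fps (carlitz_poly a)) n * u_param \<iota> \<pi> z ^ n) sums u_param \<iota> \<pi> (A_emb \<iota> a * z)"
    unfolding u_param_A_emb_mult using u_param_neq_0 by (intro exI[of _ r]) blast
  fix P assume "\<exists>r>0. \<forall>z. z \<notin> range (A_emb \<iota>) \<and> nrm (u_param \<iota> \<pi> z) < r \<longrightarrow>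
      (\<lambda>n. fps_nth P n * u_param \<iota> \<pi> z ^ n) sums u_param \<iota> \<pi> (A_emb \<iota> a * z)"
  then obtain r' where "0 < r'" and r': "\<And>z. z \<notin> range (A_emb \<iota>) \<Longrightarrow> nrm (u_param \<iota> \<pi> z) < r' \<Longrightarrow>
      (\<lambda>n. fps_nth P n * u_param \<iota> \<pi> z ^ n) sums u_param \<iota> \<pi> (A_emb \<iota> a * z)"
    by blast
  have "P - recip_fps (carlitz_poly a) = 0"
  proof (rule fps_eq_0_if_sums_0)
    fix \<epsilon> :: real assume "0 < \<epsilon>"
    then obtain z where z: "z \<notin> range (A_emb \<iota>)" "nrm (u_param \<iota> \<pi> z) < min \<epsilon> (min r r')"
      using ex_small_u_param[of "min \<epsilon> (min r r')"] \<open>0 < r\<close> \<open>0 < r'\<close> by auto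
    let ?t = "u_param \<iota> \<pi> z"
    have t: "?t \<noteq> 0" using z(1) by (rule u_param_neq_0)
    have "(\<lambda>n. fps_nth P n * ?t ^ n) sums inverse (poly (carlitz_poly a) (inverse ?t))"
      using r'[OF z(1)] z(2) by (simp add: u_param_A_emb_mult)
    moreover have "(\<lambda>n. fps_nth (recip_fps (carlitz_poly a)) n * ?t ^ n) sums
        inverse (poly (carlitz_poly a) (inverse ?t))"
      using r[OF t] z(2) by simp
    ultimately have "(\<lambda>n. fps_nth (P - recip_fps (carlitz_poly a)) n * ?t ^ n) sums 0"
      unfolding sums_def by (auto simp: left_diff_distrib sum_subtractf dest: lim_diff)
    then show "\<exists>t. t \<noteq> 0 \<and> nrm t < \<epsilon> \<and> (\<lambda>n. fps_nth (P - recip_fps (carlitz_poly a)) n * t ^ n) sums 0"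
      using t z(2) by (intro exI[of _ ?t]) simp
  qed
  then show "P = recip_fps (carlitz_poly a)" by simp
qed

lemma e_division_eq_0_iff:
  assumes "g \<noteq> 0"
  shows "e (A_emb \<iota> b * \<pi> / A_emb \<iota> g) = 0 \<longleftrightarrow> g dvd b"
proof -
  have "A_emb \<iota> b * \<pi> / A_emb \<iota> g = A_emb \<iota> c * \<pi> \<longleftrightarrow> b = g * c" for c
  proof -
    have "A_emb \<iota> b * \<pi> / A_emb \<iota> g = A_emb \<iota> c * \<pi> \<longleftrightarrow> A_emb \<iota> b = A_emb \<iota> (g * c)"
      using assms by (simp add: divide_eq_eq A_emb_mult mult_ac)
    then show ?thesis by (simp only: A_emb_eq_iff)
  qed
  then show ?thesis
    unfolding e_eq_0_iff by (auto simp: carlitz_lattice_def image_iff dvd_def)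
qed

lemma carlitz_poly_e: "poly (carlitz_poly a) (e z) = e (A_emb \<iota> a * z)"
  by (simp add: poly_carlitz_poly e_A_emb_mult)

lemma carlitz_poly_e_diff:
  "poly (carlitz_poly a) (e v - e w) = poly (carlitz_poly a) (e v) - poly (carlitz_poly a) (e w)"
  by (simp only: e_diff[symmetric] carlitz_poly_e right_diff_distrib)

lemma infinite_range_e: "infinite (range e)"
  using infinite_e_image[of 1] by (rule infinite_super[rotated]) auto

text \<open>At a point \<open>e z\<close> both sides are \<open>e\<close> of \<open>a b z\<close>,
  and \<open>e\<close> has infinitely many values.\<close>

lemma carlitz_poly_commute:
  "pcompose (carlitz_poly a) (carlitz_poly b) = pcompose (carlitz_poly b) (carlitz_poly a)"
  by (rule poly_eqI_infinite[OF infinite_range_e]) (auto simp: poly_pcompose carlitz_poly_e mult_ac)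

text \<open>Additivity of \<open>C_a\<close> as a polynomial identity, inherited from additivity of
  \<open>e\<close>. The shift is by a value of \<open>e\<close>, which covers all division
  points.\<close>

lemma carlitz_poly_shift:
  "pcompose (carlitz_poly a) [:e w, 1:] = pcompose [:poly (carlitz_poly a) (e w), 1:] (carlitz_poly a)"
proof (rule poly_eqI_infinite[OF infinite_range_e])
  fix x assume "x \<in> range e"
  then obtain z where "x = e z" by auto
  then show "poly (pcompose (carlitz_poly a) [:e w, 1:]) x =
      poly (pcompose [:poly (carlitz_poly a) (e w), 1:] (carlitz_poly a)) x"
    by (simp add: poly_pcompose carlitz_poly_e distrib_left flip: e_add)
qed

end

section \<open>The division points of \<open>g\<close>\<close>

locale carlitz_torsion = carlitz_uniformization \<iota> \<pi>
  for \<iota> :: "'q::{field,finite} fls \<Rightarrow> 'c::{field,complete_space}" and \<pi> :: 'c +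
  fixes g :: "'q poly"
  assumes monic: "lead_coeff g = 1"
begin

abbreviation L where "L \<equiv> division_points \<iota> g"

lemma g_nonzero: "g \<noteq> 0"
  using monic by auto

lemma carlitz_poly_g_nonzero: "carlitz_poly g \<noteq> 0"
  using degree_carlitz_poly(2)[OF monic] by auto

lemma L_eq: "L = {x. poly (carlitz_poly g) x = 0}"
  by (simp add: division_points_def poly_carlitz_poly)

text \<open>The classes of \<open>b \<pi> / g\<close> modulo the lattice give
  \<open>q ^ degree g\<close> distinct roots of \<open>C_g\<close>, which is already the maximal
  number of roots.\<close>

lemma bij_betw_division_points:
  "bij_betw (\<lambda>b. e (A_emb \<iota> b * \<pi> / A_emb \<iota> g)) (polys_below (degree g)) L"
  unfolding bij_betw_def
proof
  let ?W = "\<lambda>b. e (A_emb \<iota> b * \<pi> / A_emb \<iota> g)"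
  show inj: "inj_on ?W (polys_below (degree g))"
  proof (rule inj_onI)
    fix b b' assume b: "b \<in> polys_below (degree g)" "b' \<in> polys_below (degree g)" "?W b = ?W b'"
    then have "e (A_emb \<iota> (b - b') * \<pi> / A_emb \<iota> g) = 0"
      by (simp add: A_emb_diff left_diff_distrib diff_divide_distrib e_diff)
    then have "g dvd b - b'" using e_division_eq_0_iff[OF g_nonzero] by blast
    moreover have "b - b' = 0 \<or> degree (b - b') < degree g"
      using polys_below_diff[OF b(1,2)] by (simp add: polys_below_iff)
    ultimately show "b = b'" using dvd_imp_degree_le[of g "b - b'"] by force
  qed
  have fin: "finite L"
    unfolding L_eq using carlitz_poly_g_nonzero by (rule poly_roots_finite)
  have sub: "?W ` polys_below (degree g) \<subseteq> L"
    using e_lattice lattice_memI g_nonzero by (auto simp: L_eq carlitz_poly_e)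
  have "card L \<le> card (?W ` polys_below (degree g))"
    unfolding card_image[OF inj] card_polys_below L_eq
    using card_poly_roots_bound[OF carlitz_poly_g_nonzero] degree_carlitz_poly(1)[OF monic] by simp
  then show "?W ` polys_below (degree g) = L"
    using card_seteq[OF fin sub] by simp
qed

lemma division_point_ex:
  assumes "m \<in> L"
  shows "\<exists>b. m = e (A_emb \<iota> b * \<pi> / A_emb \<iota> g)"
  using assms bij_betw_imp_surj_on[OF bij_betw_division_points] by auto

lemma card_L: "card L = CARD('q) ^ degree g"
  using bij_betw_same_card[OF bij_betw_division_points] by (simp add: card_polys_below)

lemma finite_subgroup_L: "finite_subgroup L"
proof
  show "finite L"
    unfolding L_eq using carlitz_poly_g_nonzero by (rule poly_roots_finite)
  show "0 \<in> L"
    using carlitz_poly_e[of g 0] by (simp add: L_eq)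
  show "x - y \<in> L" if xy: "x \<in> L" "y \<in> L" for x y
  proof -
    obtain v w where "x = e v" "y = e w"
      using division_point_ex[OF xy(1)] division_point_ex[OF xy(2)] by blast
    then show ?thesis
      using xy carlitz_poly_e_diff[of g v w] by (simp add: L_eq)
  qed
qed

sublocale L: finite_subgroup L
  by (rule finite_subgroup_L)

text \<open>Both polynomials are monic of degree \<open>card L\<close> and vanish on
  \<open>L\<close>; for the product this uses that \<open>L\<close> is closed under
  negation.\<close>

lemma prod_division_points: "(\<Prod>m\<in>L. [:m, 1:]) = carlitz_poly g"
proof (rule poly_eqI_degree_lead_coeff[where n = "card L" and A = L])
  have deg: "degree (\<Prod>m\<in>L. [:m, 1:]) = card L"
    by (subst degree_prod_sum_eq) auto
  moreover have "lead_coeff (\<Prod>m\<in>L. [:m, 1:]) = 1"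
    by (simp add: lead_coeff_prod)
  ultimately show "coeff (\<Prod>m\<in>L. [:m, 1:]) (card L) = coeff (carlitz_poly g) (card L)"
    using degree_carlitz_poly[OF monic] by (simp add: card_L)
  show "degree (\<Prod>m\<in>L. [:m, 1:]) \<le> card L" using deg by simp
  show "degree (carlitz_poly g) \<le> card L"
    using degree_carlitz_poly[OF monic] by (simp add: card_L)
  fix z assume z: "z \<in> L"
  then have "poly (\<Prod>m\<in>L. [:m, 1:]) z = 0"
    using L.finite_L L.minus_mem[OF z] by (auto simp: poly_prod intro!: bexI[of _ "- z"])
  then show "poly (\<Prod>m\<in>L. [:m, 1:]) z = poly (carlitz_poly g) z"
    using z by (simp add: L_eq)
qed simp

text \<open>The two polynomials are proportional, and comparing their linear coefficients, 1 and
  \<open>g\<close>, fixes the factor.\<close>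

lemma poly_exp_poly_division_points:
  "A_emb \<iota> g * poly (exp_poly L) y = poly (carlitz_poly g) y"
proof -
  have "(\<Prod>w\<in>L. [:- w, 1:]) = (\<Prod>m\<in>L. [:m, 1:])"
    by (rule prod.reindex_bij_witness[of _ uminus uminus]) (auto simp: L.minus_mem)
  then obtain c where c: "exp_poly L = smult c (carlitz_poly g)"
    using L.exp_poly_eq_smult prod_division_points by metis
  then have "c * A_emb \<iota> g = 1"
    using L.coeff_exp_poly_1 by (simp only: c coeff_smult coeff_carlitz_poly_1)
  then show ?thesis
    by (simp add: c mult.assoc[symmetric] mult.commute[of "A_emb \<iota> g"])
qed

text \<open>Distribution relation: \<open>A\<close> is the disjoint union of the classes \<open>b + g A\<close> with
  \<open>deg b < deg g\<close>.\<close>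

lemma sum_goss_division_points:
  assumes "0 < n" and gz: "A_emb \<iota> g * z \<notin> \<Lambda>"
  shows "(\<Sum>m\<in>L. poly (goss carlitz_coeff n) (inverse (e z + m))) =
    A_emb \<iota> g ^ n * poly (goss carlitz_coeff n) (inverse (poly (carlitz_poly g) (e z)))"
proof -
  let ?G = "A_emb \<iota> g"
  let ?z = "\<lambda>b. z + A_emb \<iota> b * \<pi> / ?G"
  have G: "?G \<noteq> 0" using g_nonzero by simp
  \<comment> \<open>Scaling by \<open>g\<close> carries the \<open>g\<close>-division translates of
    the lattice into the lattice; this is the source of the factor \<open>g ^ n\<close>.\<close>
  have G_mult: "?G * (?z b + A_emb \<iota> c * \<pi>) = ?G * z + A_emb \<iota> (b + g * c) * \<pi>" for b c
    using G by (simp add: A_emb_add A_emb_mult field_simps)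
  have z_b: "?z b \<notin> \<Lambda>" for b
  proof
    assume "?z b \<in> \<Lambda>"
    then obtain c where "?z b = A_emb \<iota> c * \<pi>" by (auto simp: carlitz_lattice_def)
    then have "?G * z = A_emb \<iota> (g * c - b) * \<pi>"
      using G by (simp add: A_emb_diff A_emb_mult field_simps)
    then show False using gz lattice_memI by simp
  qed
  have "(\<Sum>m\<in>L. poly (goss carlitz_coeff n) (inverse (e z + m))) =
      (\<Sum>b\<in>polys_below (degree g). power_sum n (?z b))"
    by (subst sum.reindex_bij_betw[OF bij_betw_division_points, symmetric])
       (use power_sum_eq_poly_goss[OF z_b assms(1)] in \<open>simp add: e_add\<close>)
  also have "\<dots> = ?G ^ n * power_sum n (?G * z)"
  \<comment> \<open>The relation is exact at finite level: residues of degree below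
    \<open>degree g\<close> and quotients of degree below \<open>k\<close> together give all
    polynomials of degree below \<open>degree g + k\<close>.\<close>
  proof (rule LIMSEQ_unique)
    show "(\<lambda>k. \<Sum>b\<in>polys_below (degree g). \<Sum>w\<in>lat k. inverse ((?z b + w) ^ n)) \<longlonglongrightarrow>
        (\<Sum>b\<in>polys_below (degree g). power_sum n (?z b))"
      by (intro lim_sum tendsto_power_sum assms(1))
    have "(\<Sum>b\<in>polys_below (degree g). \<Sum>w\<in>lat k. inverse ((?z b + w) ^ n)) =
        ?G ^ n * (\<Sum>w\<in>lat (k + degree g). inverse ((?G * z + w) ^ n))" for k
    proof -
      have "(\<Sum>b\<in>polys_below (degree g). \<Sum>w\<in>lat k. inverse ((?z b + w) ^ n)) =
          (\<Sum>(b, c)\<in>polys_below (degree g) \<times> polys_below k. inverse ((?z b + A_emb \<iota> c * \<pi>) ^ n))"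
        unfolding lat_def by (simp add: sum.reindex[OF inj_lat] sum.cartesian_product)
      also have "\<dots> = (\<Sum>p\<in>polys_below (degree g) \<times> polys_below k.
          ?G ^ n * inverse ((?G * z + A_emb \<iota> (case p of (b, c) \<Rightarrow> b + g * c) * \<pi>) ^ n))"
      proof (intro sum.cong refl, clarify)
        fix b c
        have "?G ^ n * inverse ((?G * (?z b + A_emb \<iota> c * \<pi>)) ^ n) = inverse ((?z b + A_emb \<iota> c * \<pi>) ^ n)"
          using G by (simp add: power_mult_distrib)
        then show "inverse ((?z b + A_emb \<iota> c * \<pi>) ^ n) =
            ?G ^ n * inverse ((?G * z + A_emb \<iota> (b + g * c) * \<pi>) ^ n)"
          by (simp only: G_mult)
      qed
      also have "\<dots> = (\<Sum>a\<in>polys_below (degree g + k). ?G ^ n * inverse ((?G * z + A_emb \<iota> a * \<pi>) ^ n))"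
        by (rule sum.reindex_bij_betw[OF bij_betw_polys_below[OF g_nonzero]])
      also have "\<dots> = ?G ^ n * (\<Sum>w\<in>lat (k + degree g). inverse ((?G * z + w) ^ n))"
        unfolding lat_def by (simp add: sum.reindex[OF inj_lat] sum_distrib_left add.commute)
      finally show ?thesis .
    qed
    then show "(\<lambda>k. \<Sum>b\<in>polys_below (degree g). \<Sum>w\<in>lat k. inverse ((?z b + w) ^ n)) \<longlonglongrightarrow>
        ?G ^ n * power_sum n (?G * z)"
      using LIMSEQ_ignore_initial_segment[OF tendsto_power_sum[OF assms(1), of "?G * z"], of "degree g"]
      by (simp add: lim_mult)
  qed
  also have "power_sum n (?G * z) = poly (goss carlitz_coeff n) (inverse (poly (carlitz_poly g) (e z)))"
    using power_sum_eq_poly_goss[OF gz assms(1)] by (simp add: carlitz_poly_e)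
  finally show ?thesis .
qed

text \<open>The formal version of the distribution relation, transferred from the infinitely many
  values \<open>y = e z\<close> to the variable \<open>X = 1/y\<close>.\<close>

lemma sum_goss_fps:
  assumes "0 < n"
  shows "(\<Sum>m\<in>L. poly_fps (goss carlitz_coeff n) (recip_fps [:m, 1:])) =
    fps_const (A_emb \<iota> g ^ n) * poly_fps (goss carlitz_coeff n) (recip_fps (carlitz_poly g))"
proof -
  have "(\<Sum>m\<in>L. poly_fps (goss carlitz_coeff n) (recip_fps [:m, 1:])) =
      poly_fps (smult (A_emb \<iota> g ^ n) (goss carlitz_coeff n)) (recip_fps (\<Prod>m\<in>L. [:m, 1:]))"
  proof (rule sum_poly_fps_recip[OF L.finite_L infinite_e_image[OF g_nonzero]])
    fix y assume "y \<in> e ` {z. A_emb \<iota> g * z \<notin> \<Lambda>}"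
    then obtain z where z: "A_emb \<iota> g * z \<notin> \<Lambda>" "y = e z" by auto
    have "(\<Prod>m\<in>L. y + m) = poly (carlitz_poly g) y"
      by (simp add: poly_prod add.commute flip: prod_division_points)
    then show "(\<Sum>m\<in>L. poly (goss carlitz_coeff n) (inverse (y + m))) =
        poly (smult (A_emb \<iota> g ^ n) (goss carlitz_coeff n)) (inverse (\<Prod>m\<in>L. y + m))"
      using sum_goss_division_points[OF assms z(1)] by (simp add: z(2))
  qed
  then show ?thesis by (simp add: prod_division_points poly_fps_smult)
qed

section \<open>The operator \<open>T_hat\<close> as a trace over the division points\<close>

definition torsion_goss :: "nat \<Rightarrow> 'c fps" where
  "torsion_goss j = poly_fps (goss_poly j L) (fps_const (A_emb \<iota> g) * fps_X)"

lemma torsion_goss_eq: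
  "torsion_goss j = fps_of_poly (pcompose (goss_poly j L) [:0, A_emb \<iota> g:])"
  by (simp add: torsion_goss_def poly_fps_eq_compose fps_of_poly_pcompose fps_of_poly_pCons mult.commute)

lemma torsion_goss_nth_eq_0:
  assumes "0 < j" "card L * i < j"
  shows "fps_nth (torsion_goss j) i = 0"
proof -
  have "coeff (goss_poly j L) i = 0"
    unfolding goss_poly_finite[OF finite_subgroup_L assms(1)]
    by (rule coeff_goss_eq_0[OF _ L.card_pos assms(2)])
       (simp add: coeff_eq_0 L.degree_exp_poly)
  then show ?thesis by (simp add: torsion_goss_eq coeff_pcompose_linear)
qed

lemma recip_carlitz_poly_nth_0: "lead_coeff a = 1 \<Longrightarrow> fps_nth (recip_fps (carlitz_poly a)) 0 = 0"
  by (intro recip_fps_nth_eq_0) (simp add: degree_carlitz_poly)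

text \<open>At \<open>u = 1/C_g(y)\<close> the argument \<open>g u\<close> equals
  \<open>1/e_L(y)\<close>, so the Goss polynomial becomes the sum of the \<open>(y + m)\<close> to
  the power \<open>- j\<close>; and \<open>recip_fps [:m, 1:]\<close> is \<open>1/(y + m)\<close>
  for \<open>y = 1/X\<close>.\<close>

lemma torsion_goss_compose:
  assumes "0 < j"
  shows "torsion_goss j oo recip_fps (carlitz_poly g) = (\<Sum>m\<in>L. recip_fps [:m, 1:] ^ j)"
proof -
  define R where "R = pcompose (goss_poly j L) [:0, A_emb \<iota> g:]"
  have "(\<Sum>m\<in>L. poly_fps (monom 1 j) (recip_fps [:m, 1:])) = poly_fps R (recip_fps (\<Prod>m\<in>L. [:m, 1:]))"
  proof (rule sum_poly_fps_recip[OF L.finite_L, of "- L"])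
    show "infinite (- L)"
      using infinite_UNIV L.finite_L by (simp add: Compl_eq_Diff_UNIV)
    fix y assume "y \<in> - L"
    then have y: "y \<notin> L" by simp
    have "(\<Prod>m\<in>L. y + m) = A_emb \<iota> g * poly (exp_poly L) y"
      unfolding poly_exp_poly_division_points
      by (simp add: poly_prod add.commute flip: prod_division_points)
    then have "inverse (\<Prod>m\<in>L. y + m) * A_emb \<iota> g = inverse (poly (exp_poly L) y)"
      using g_nonzero by (simp add: field_simps)
    then have "poly R (inverse (\<Prod>m\<in>L. y + m)) =
        poly (goss (coeff (exp_poly L)) j) (inverse (poly (exp_poly L) y))"
      by (simp add: R_def poly_pcompose goss_poly_finite[OF finite_subgroup_L assms])
    also have "\<dots> = (\<Sum>m\<in>L. inverse ((y + m) ^ j))"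
      using L.power_sum_recursion[OF infinite_UNIV y] assms
      by (rule poly_goss_eqI[where s = "\<lambda>j. \<Sum>l\<in>L. inverse ((y + l) ^ j)"])
    finally show "(\<Sum>m\<in>L. poly (monom 1 j) (inverse (y + m))) = poly R (inverse (\<Prod>m\<in>L. y + m))"
      by (simp add: poly_monom power_inverse)
  qed
  moreover have "poly_fps (monom 1 j) F = F ^ j" for F :: "'c fps"
    by (simp add: poly_fps_def map_poly_monom poly_monom)
  ultimately show ?thesis
    using recip_carlitz_poly_nth_0[OF monic]
    by (simp add: prod_division_points torsion_goss_eq R_def poly_fps_eq_compose)
qed

text \<open>The bound \<open>J\<close> is left free so that several coefficients, or several series
  \<open>F\<close>, can share one truncation.\<close>

lemma T_hat_nth:
  assumes "card L * i \<le> J"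
  shows "fps_nth (T_hat \<iota> g F) i = (\<Sum>j=1..J. fps_nth F j * fps_nth (torsion_goss j) i)"
proof -
  have "fps_nth (T_hat \<iota> g F) i = (\<Sum>j\<in>{1..J}. fps_nth (fps_const (fps_nth F j) * torsion_goss j) i)"
    unfolding T_hat_def torsion_goss_def[symmetric]
  proof (rule fps_infsum_nth)
    show "finite {j \<in> {1..}. fps_nth (fps_const (fps_nth F j) * torsion_goss j) k \<noteq> 0}" for k
      by (rule finite_subset[of _ "{..card L * k}"])
         (use torsion_goss_nth_eq_0 in \<open>force simp: not_le[symmetric]\<close>, simp)
    show "j \<in> {1..J}" if "j \<in> {1..}" "fps_nth (fps_const (fps_nth F j) * torsion_goss j) i \<noteq> 0" for j
      using that torsion_goss_nth_eq_0[of j i] assms by (cases "j \<le> J") auto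
  qed auto
  then show ?thesis by simp
qed

lemma T_hat_compose:
  assumes "fps_nth F 0 = 0"
  shows "T_hat \<iota> g F oo recip_fps (carlitz_poly g) = (\<Sum>m\<in>L. F oo recip_fps [:m, 1:])"
proof (rule fps_ext)
  fix k
  let ?V = "recip_fps (carlitz_poly g)"
  \<comment> \<open>One bound serves both sides: \<open>card L * k\<close> for the coefficients of
    \<open>T_hat\<close> up to index \<open>k\<close>, and \<open>k\<close> for truncating the
    substitution into \<open>F\<close>.\<close>
  define J where "J = max k (card L * k)"
  have J: "card L * i \<le> J" if "i \<le> k" for i
    unfolding J_def using that by (intro max.coboundedI2 mult_le_mono2)
  have "fps_nth (T_hat \<iota> g F oo ?V) k =
      (\<Sum>i=0..k. \<Sum>j=1..J. fps_nth F j * (fps_nth (torsion_goss j) i * fps_nth (?V ^ i) k))"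
    by (simp add: fps_compose_nth T_hat_nth[OF J] sum_distrib_right mult.assoc)
  also have "\<dots> = (\<Sum>j=1..J. fps_nth F j * fps_nth (torsion_goss j oo ?V) k)"
    by (subst sum.swap) (simp add: fps_compose_nth sum_distrib_left)
  also have "\<dots> = (\<Sum>m\<in>L. \<Sum>j=1..J. fps_nth F j * fps_nth (recip_fps [:m, 1:] ^ j) k)"
    by (subst sum.swap) (simp add: torsion_goss_compose fps_sum_nth sum_distrib_left)
  also have "\<dots> = (\<Sum>m\<in>L. fps_nth (F oo recip_fps [:m, 1:]) k)"
  proof (rule sum.cong[OF refl])
    fix m assume "m \<in> L"
    have "fps_nth (recip_fps [:m, 1:]) 0 = 0" by (simp add: recip_fps_nth_eq_0)
    then have 0: "fps_nth (recip_fps [:m, 1:] ^ j) k = 0" if "k < j" for j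
      using that startsby_zero_power_prefix by blast
    show "(\<Sum>j=1..J. fps_nth F j * fps_nth (recip_fps [:m, 1:] ^ j) k) =
        fps_nth (F oo recip_fps [:m, 1:]) k"
      unfolding fps_compose_nth
      \<comment> \<open>The substitution also has a term \<open>j = 0\<close>, which vanishes
        because \<open>F\<close> has no constant term.\<close>
      by (rule sum.mono_neutral_cong) (use assms 0 in \<open>auto simp: J_def not_le Suc_le_eq\<close>)
  qed
  finally show "fps_nth (T_hat \<iota> g F oo ?V) k = fps_nth (\<Sum>m\<in>L. F oo recip_fps [:m, 1:]) k"
    by (simp add: fps_sum_nth)
qed

text \<open>On \<open>b \<pi> / g\<close> modulo the lattice the map is multiplication by
  \<open>a\<close>, which is injective modulo the prime \<open>g\<close>; since \<open>L\<close> is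
  finite, that suffices.\<close>

lemma bij_betw_carlitz_division_points:
  assumes "prime_elem g" "\<not> g dvd a"
  shows "bij_betw (poly (carlitz_poly a)) L L"
proof -
  have "poly (carlitz_poly a) ` L \<subseteq> L"
  proof clarify
    fix m assume m: "m \<in> L"
    have "poly (carlitz_poly g) (poly (carlitz_poly a) m) = poly (carlitz_poly a) (poly (carlitz_poly g) m)"
      using carlitz_poly_commute[of g a] by (metis poly_pcompose)
    also have "\<dots> = 0"
      using m carlitz_poly_e[of a 0] by (simp add: L_eq)
    finally show "poly (carlitz_poly a) m \<in> L" by (simp add: L_eq)
  qed
  moreover have "inj_on (poly (carlitz_poly a)) L"
  proof (rule inj_onI)
    fix m m' assume m: "m \<in> L" "m' \<in> L" "poly (carlitz_poly a) m = poly (carlitz_poly a) m'"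
    obtain b b' where b: "m = e (A_emb \<iota> b * \<pi> / A_emb \<iota> g)" "m' = e (A_emb \<iota> b' * \<pi> / A_emb \<iota> g)"
      using division_point_ex[OF m(1)] division_point_ex[OF m(2)] by blast
    have "e (A_emb \<iota> (a * (b - b')) * \<pi> / A_emb \<iota> g) =
        poly (carlitz_poly a) m - poly (carlitz_poly a) m'"
      by (simp add: b carlitz_poly_e A_emb_diff A_emb_mult algebra_simps diff_divide_distrib flip: e_diff)
    then have "g dvd a * (b - b')"
      using m(3) by (simp add: e_division_eq_0_iff[OF g_nonzero])
    then have "g dvd b - b'"
      using assms by (simp add: prime_elem_dvd_mult_iff)
    then have "e (A_emb \<iota> (b - b') * \<pi> / A_emb \<iota> g) = 0"
      by (simp add: e_division_eq_0_iff[OF g_nonzero])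
    then show "m = m'"
      by (simp add: b A_emb_diff left_diff_distrib diff_divide_distrib e_diff)
  qed
  ultimately show ?thesis
    unfolding bij_betw_def using endo_inj_surj[OF L.finite_L] by blast
qed

lemma T_hat_goss_u_sub:
  assumes "prime_elem g" "\<not> g dvd a" and a: "lead_coeff a = 1" and "0 < n"
  defines "F \<equiv> poly_fps (goss carlitz_coeff n) (recip_fps (carlitz_poly a))"
  shows "T_hat \<iota> g F = fps_const (A_emb \<iota> g ^ n) * F"
proof -
  let ?P = "goss carlitz_coeff n"
  let ?V = "\<lambda>a. recip_fps (carlitz_poly a)"
  have V0: "fps_nth (?V a) 0 = 0" "fps_nth (?V g) 0 = 0"
    by (rule recip_carlitz_poly_nth_0[OF a], rule recip_carlitz_poly_nth_0[OF monic])
  have nz: "carlitz_poly a \<noteq> 0" using degree_carlitz_poly(2)[OF a] by fastforce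
  have deg: "0 < degree (carlitz_poly a)" "0 < degree (carlitz_poly g)"
    by (simp_all add: degree_carlitz_poly(1)[OF a] degree_carlitz_poly(1)[OF monic])
  have F0: "fps_nth F 0 = 0"
    unfolding F_def by (rule poly_fps_nth_eq_0[where N = 1]) (simp_all add: V0)
  \<comment> \<open>In the variable \<open>y = 1/X\<close> this reads
    \<open>1/C_a(y + m) = 1/(C_a(y) + C_a(m))\<close>.\<close>
  have comp: "?V a oo recip_fps [:m, 1:] = recip_fps [:poly (carlitz_poly a) m, 1:] oo ?V a"
    if m: "m \<in> L" for m
  proof -
    obtain w where w: "m = e w" using division_point_ex[OF m] by blast
    show ?thesis
      using carlitz_poly_shift[of a w] deg nz
      by (simp add: recip_fps_pcompose[OF infinite_UNIV, symmetric] w)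
  qed
  have "T_hat \<iota> g F oo ?V g = (\<Sum>m\<in>L. poly_fps ?P (recip_fps [:poly (carlitz_poly a) m, 1:]) oo ?V a)"
    unfolding T_hat_compose[OF F0]
    by (intro sum.cong refl) (simp add: F_def poly_fps_compose recip_fps_nth_eq_0 comp V0)
  also have "\<dots> = (\<Sum>m\<in>L. poly_fps ?P (recip_fps [:m, 1:]) oo ?V a)"
    by (rule sum.reindex_bij_betw[OF bij_betw_carlitz_division_points[OF assms(1,2)]])
  also have "\<dots> = (fps_const (A_emb \<iota> g ^ n) * poly_fps ?P (?V g)) oo ?V a"
    by (simp add: sum_goss_fps[OF assms(4)] flip: fps_compose_sum_distrib)
  also have "\<dots> = fps_const (A_emb \<iota> g ^ n) * poly_fps ?P (?V g oo ?V a)"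
    by (simp add: fps_compose_mult_distrib V0 poly_fps_compose)
  \<comment> \<open>Commuting the two series makes the expansion of \<open>u_g\<close> the one
    substituted last, so that it can be cancelled from both sides.\<close>
  also have "?V g oo ?V a = ?V a oo ?V g"
    using carlitz_poly_commute[of a g] deg nz carlitz_poly_g_nonzero
    by (simp add: recip_fps_pcompose[OF infinite_UNIV, symmetric])
  also have "fps_const (A_emb \<iota> g ^ n) * poly_fps ?P (?V a oo ?V g) =
      (fps_const (A_emb \<iota> g ^ n) * F) oo ?V g"
    by (simp add: F_def fps_compose_mult_distrib V0 poly_fps_compose)
  finally show ?thesis
    by (rule fps_compose_inj[OF V0(2) recip_fps_neq_0[OF carlitz_poly_g_nonzero]])
qed

text \<open>A fixed coefficient involves only finitely many \<open>j\<close> in \<open>T_hat\<close>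
  and finitely many \<open>a\<close> in \<open>f_zero\<close>, so the two sums may be interchanged
  and the result for a single \<open>a\<close> applies.\<close>

lemma T_hat_f_zero:
  assumes "prime_elem g" "0 < n"
  shows "T_hat \<iota> g (f_zero \<iota> \<pi> g k n) = fps_const (A_emb \<iota> g ^ n) * f_zero \<iota> \<pi> g k n"
proof (rule fps_ext)
  fix i
  define I where "I = {a. lead_coeff a = 1 \<and> \<not> g dvd a}"
  define F where "F = (\<lambda>a. poly_fps (goss carlitz_coeff n) (recip_fps (carlitz_poly a)))"
  define f where "f = (\<lambda>a. fps_const (A_emb \<iota> a ^ (k - n)) * F a)"
  define J where "J = max i (card L * i)"
  define S where "S = I \<inter> polys_below (Suc J)"
  have f_zero: "f_zero \<iota> \<pi> g k n = infsum f I"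
    unfolding f_zero_def I_def[symmetric]
    by (rule infsum_cong)
       (simp add: f_def F_def goss_poly_lattice[OF assms(2)] u_sub_eq I_def)
  \<comment> \<open>The expansion of \<open>u_a\<close> vanishes to order
    \<open>q ^ degree a\<close>, which exceeds \<open>degree a\<close>; so coefficient
    \<open>j\<close> sees only \<open>a\<close> of degree at most \<open>j\<close>.\<close>
  have f_nth: "fps_nth (f a) j = 0" if "a \<in> I" "a \<notin> polys_below (Suc j)" for a j
  proof -
    have "j < degree a" using that by (auto simp: polys_below_iff)
    also have "\<dots> < degree (carlitz_poly a)"
      using that(1) card_gt_1 by (simp add: I_def degree_carlitz_poly(1) power_gt_expt)
    finally have "fps_nth (F a) j = 0"
      unfolding F_def by (rule poly_fps_nth_eq_0[rotated 2]) (auto simp: recip_fps_nth_eq_0)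
    then show ?thesis by (simp add: f_def)
  qed
  have S: "fps_nth (infsum f I) j = (\<Sum>a\<in>S. fps_nth (f a) j)" if "j \<le> J" for j
  proof (rule fps_infsum_nth)
    show "finite {a \<in> I. fps_nth (f a) k \<noteq> 0}" for k
      by (rule finite_subset[OF _ finite_polys_below[of "Suc k"]]) (use f_nth in blast)
    have "polys_below (Suc j) \<subseteq> polys_below (Suc J)"
      using that by (auto simp: polys_below_def)
    then show "a \<in> S" if "a \<in> I" "fps_nth (f a) j \<noteq> 0" for a
      using f_nth[of a j] that by (auto simp: S_def)
  qed (auto simp: S_def finite_polys_below)
  have J: "card L * i \<le> J" by (simp add: J_def)
  have "fps_nth (T_hat \<iota> g (infsum f I)) i =
      (\<Sum>j=1..J. (\<Sum>a\<in>S. fps_nth (f a) j) * fps_nth (torsion_goss j) i)"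
    by (simp add: T_hat_nth[OF J] S)
  also have "\<dots> = (\<Sum>a\<in>S. A_emb \<iota> a ^ (k - n) * fps_nth (T_hat \<iota> g (F a)) i)"
    unfolding sum_distrib_right
    by (subst sum.swap) (simp add: T_hat_nth[OF J] sum_distrib_left f_def mult.assoc)
  also have "\<dots> = (\<Sum>a\<in>S. A_emb \<iota> g ^ n * fps_nth (f a) i)"
  proof (rule sum.cong[OF refl])
    fix a assume "a \<in> S"
    then have "T_hat \<iota> g (F a) = fps_const (A_emb \<iota> g ^ n) * F a"
      unfolding F_def using assms by (intro T_hat_goss_u_sub) (auto simp: S_def I_def)
    then show "A_emb \<iota> a ^ (k - n) * fps_nth (T_hat \<iota> g (F a)) i = A_emb \<iota> g ^ n * fps_nth (f a) i"
      by (simp add: f_def)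
  qed
  also have "\<dots> = fps_nth (fps_const (A_emb \<iota> g ^ n) * infsum f I) i"
    by (simp add: S J_def sum_distrib_left)
  finally show "fps_nth (T_hat \<iota> g (f_zero \<iota> \<pi> g k n)) i =
      fps_nth (fps_const (A_emb \<iota> g ^ n) * f_zero \<iota> \<pi> g k n) i"
    by (simp only: f_zero)
qed

end

theorem theorem4p6:
  fixes \<iota> :: "'q::{field,finite} fls \<Rightarrow> 'c::{field,complete_space}"
    and \<pi> :: 'c
    and g :: "'q poly"
    and k\<^sub>0 n :: nat
  assumes "C_infty \<iota>"
    and "carlitz_period \<iota> \<pi>"
    and "irreducible g" and "lead_coeff g = 1"
    and "0 < k\<^sub>0" and "0 < n"
    and "\<exists>m::nat. 0 < m \<and> k\<^sub>0 = 2 * n + m * (CARD('q) - 1)"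
    and "n \<le> CHAR('q) ^ multiplicity CHAR('q) (k\<^sub>0 - n)"
  shows "T_hat \<iota> g (f_zero \<iota> \<pi> g k\<^sub>0 n) = fps_const (A_emb \<iota> g ^ n) * f_zero \<iota> \<pi> g k\<^sub>0 n"
proof -
  interpret carlitz_torsion \<iota> \<pi> g
    using assms by (simp add: carlitz_torsion_def carlitz_torsion_axioms_def
        carlitz_uniformization_def carlitz_uniformization_axioms_def)
  show ?thesis
    using field_poly_irreducible_imp_prime[OF assms(3)] assms(6) by (rule T_hat_f_zero)
qed

end
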